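(* Let $\gamma>0$, $a>0$ and $p\geq 1$. Suppose there exists $s_0\geq 0$ such that for each $s>s_0$ there is a constant $C_s$ with $$\Big\|\sup_{0<t<1}|P_{a,\gamma}^t f|\Big\|_{L^p(B(0,1))}\leq C_s\|f\|_{H^s(\mathbb R)}\quad\text{for all } f\in H^s(\mathbb R).$$ Then for each $s>s_0$, each $0\leq\delta<a$ and all $f\in H^{s+\delta}(\mathbb R)$, $$P_{a,\gamma}^t f(x)-f(x)=o\big(t^{\delta\min\{1,\gamma\}/a}\big)\quad\text{as } t\to 0^+,\ \text{for a.e. } x\in\mathbb R.$$
   Context: The Fourier transform is $\hat f(\xi)=\int_{\mathbb R}e^{-ix\xi}f(x)\,dx$. For $a>0$, $\gamma>0$, $t>0$ and $f\in L^2(\mathbb R)$, the Landau type Schrödinger operator is $$P_{a,\gamma}^t f(x)=\frac{1}{2\pi}\int_{\mathbb R}\hat f(\xi)e^{ix\xi}e^{it|\xi|^a}e^{-t^\gamma|\xi|^a}\,d\xi .$$ $H^s(\mathbb R)$ is the $L^2$-based Sobolev space with norm $\|f\|_{H^s(\mathbb R)}=\big(\int_{\mathbb R}(1+|\xi|^2)^s|\hat f(\xi)|^2\,d\xi\big)^{1/2}$. $B(0,1)=(-1,1)\subset\mathbb R$. *)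

theory Defs
  imports "HOL-Analysis.Analysis" "HOL-Library.Landau_Symbols"
begin

definition L2 :: "(real \<Rightarrow> complex) set" where
  "L2 = {f. f \<in> borel_measurable lebesgue \<and> integrable lebesgue (\<lambda>x. (cmod (f x))\<^sup>2)}"

definition fourier_integral :: "(real \<Rightarrow> complex) \<Rightarrow> real \<Rightarrow> complex" where
  "fourier_integral f \<xi> =
     (LINT x|lebesgue. exp (- \<i> * complex_of_real (x * \<xi>)) * f x)"

text \<open>
  The integral defining the Fourier transform need not converge for an element of \<open>L2\<close>.
  There the transform is, as usual, the \<open>L\<^sup>2\<close> limit of the transforms of the truncations of
  \<open>f\<close> to \<open>[-R, R]\<close>, which are integrable. The limit is determined up to a null set, and it exists
  by Plancherel's theorem; \<open>fourier\<close> selects one representative, and every use below depends only on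
  its class modulo null sets.
\<close>

definition is_fourier :: "(real \<Rightarrow> complex) \<Rightarrow> (real \<Rightarrow> complex) \<Rightarrow> bool" where
  "is_fourier f g \<longleftrightarrow> g \<in> L2 \<and>
     ((\<lambda>R. \<integral>\<^sup>+ \<xi>. ennreal ((cmod (fourier_integral (\<lambda>x. indicator {-R..R} x * f x) \<xi> - g \<xi>))\<^sup>2)
              \<partial>lebesgue) \<longlongrightarrow> 0) at_top"

definition fourier :: "(real \<Rightarrow> complex) \<Rightarrow> real \<Rightarrow> complex" where
  "fourier f = (SOME g. is_fourier f g)"

text \<open>
  Only used for \<open>s \<ge> 0\<close>, where \<open>H\<^sup>s(\<real>)\<close> is contained in \<open>L\<^sup>2(\<real>)\<close>.
\<close>

definition sobolev :: "real \<Rightarrow> (real \<Rightarrow> complex) set" where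
  "sobolev s = {f \<in> L2. integrable lebesgue (\<lambda>\<xi>. (1 + \<bar>\<xi>\<bar>\<^sup>2) powr s * (cmod (fourier f \<xi>))\<^sup>2)}"

definition sobolev_norm :: "real \<Rightarrow> (real \<Rightarrow> complex) \<Rightarrow> real" where
  "sobolev_norm s f =
     (LINT \<xi>|lebesgue. (1 + \<bar>\<xi>\<bar>\<^sup>2) powr s * (cmod (fourier f \<xi>))\<^sup>2) powr (1/2)"

text \<open>
  For \<open>t > 0\<close> and \<open>f\<close> in \<open>L2\<close> the integrand is a product of two square-integrable functions, so the
  integral converges absolutely for every \<open>x\<close>.
\<close>

definition landau_schroedinger ::
    "real \<Rightarrow> real \<Rightarrow> real \<Rightarrow> (real \<Rightarrow> complex) \<Rightarrow> real \<Rightarrow> complex" where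
  "landau_schroedinger a \<gamma> t f x =
     1 / (2 * complex_of_real pi) *
     (LINT \<xi>|lebesgue. fourier f \<xi> * exp (\<i> * complex_of_real (x * \<xi>))
        * exp (\<i> * complex_of_real (t * \<bar>\<xi>\<bar> powr a))
        * complex_of_real (exp (- (t powr \<gamma>) * \<bar>\<xi>\<bar> powr a)))"

text \<open>
  The supremum over \<open>t\<close> may be infinite at some points, so the \<open>L\<^sup>p\<close> norm is taken of functions
  with values in \<open>[0, \<infinity>]\<close>, with \<open>\<infinity>\<close> raised to a positive power equal to \<open>\<infinity>\<close>.
\<close>

definition ennreal_powr :: "ennreal \<Rightarrow> real \<Rightarrow> ennreal" where
  "ennreal_powr u p = (if u = \<infinity> then \<infinity> else ennreal (enn2real u powr p))"

definition Lp_norm :: "real \<Rightarrow> real set \<Rightarrow> (real \<Rightarrow> ennreal) \<Rightarrow> ennreal" where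
  "Lp_norm p S F = ennreal_powr (\<integral>\<^sup>+ x\<in>S. ennreal_powr (F x) p \<partial>lebesgue) (1/p)"

end

theory Submission
  imports Defs "HOL-Probability.Levy"
begin

text \<open>
  Write \<open>T\<^sub>t g\<close> for the inverse Fourier integral of \<open>g(\<xi>) exp ((i t - t\<^sup>\<gamma>) \<bar>\<xi>\<bar>\<^sup>a)\<close>, so that the operator of
  the theorem sends \<open>f\<close> to \<open>T\<^sub>t g\<close> with \<open>g\<close> the Fourier transform of \<open>f\<close>. Cut \<open>g\<close> into pieces \<open>g\<^sub>k\<close>
  living on the dyadic shells \<open>2\<^bsup>k-1\<^esup> < \<bar>\<xi>\<bar> \<le> 2\<^sup>k\<close> (and on \<open>\<bar>\<xi>\<bar> \<le> 1\<close> for \<open>k = 0\<close>). Put \<open>\<mu> = min 1 \<gamma>\<close> and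
  \<open>\<kappa> = \<delta> \<mu> / a\<close>, which is smaller than \<open>\<mu>\<close>. Each piece obeys two bounds on \<open>T\<^sub>t g\<^sub>k - T\<^sub>0 g\<^sub>k\<close> for
  \<open>0 < t < 1\<close>: the trivial one \<open>2 M\<^sub>k\<close>, with \<open>M\<^sub>k = sup\<^sub>t \<bar>T\<^sub>t g\<^sub>k\<bar>\<close>, and the one obtained by integrating
  the time derivative, \<open>(t + t\<^sup>\<gamma>) M'\<^sub>k \<le> 2 t\<^sup>\<mu> M'\<^sub>k\<close>, with \<open>M'\<^sub>k = sup\<^sub>t \<bar>T\<^sub>t (\<bar>\<xi>\<bar>\<^sup>a g\<^sub>k)\<bar>\<close>. Using the first for
  \<open>t \<ge> 2\<^bsup>-ka/\<mu>\<^esup>\<close> and the second below that threshold gives, uniformly in \<open>t\<close>,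
    \<open>t\<^bsup>-\<kappa>\<^esup> \<bar>T\<^sub>t g\<^sub>k - T\<^sub>0 g\<^sub>k\<bar> \<le> 2 (2\<^bsup>k\<delta>\<^esup> M\<^sub>k + 2\<^bsup>k(\<delta>-a)\<^esup> M'\<^sub>k)\<close>,
  while for a single \<open>k\<close> the left-hand side tends to \<open>0\<close> because \<open>\<kappa> < \<mu>\<close>. Hence Tannery's theorem (dominated
  convergence for series) yields the rate at every point where the right-hand sides are summable in
  \<open>k\<close> (\<open>smallo_of_dyadic_bounds\<close>).

  Summability almost everywhere is where the maximal estimate enters. On a ball of radius one the
  \<open>L\<^sup>p\<close> bound implies an \<open>L\<^sup>1\<close> bound (\<open>maximal_estimate_L1\<close>), and multiplying \<open>g\<close> by a character
  moves the ball anywhere. Applied with some \<open>s'\<close> between \<open>s\<^sub>0\<close> and \<open>s\<close>, it bounds the integral of the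
  \<open>k\<close>-th term by a constant times \<open>2\<^bsup>k\<delta>\<^esup> \<parallel>g\<^sub>k\<parallel>\<close> with the norm of \<open>H\<^bsup>s'\<^esup>\<close>, which is at most a constant times
  \<open>2\<^bsup>-k(s-s')\<^esup> \<parallel>f\<parallel>\<close> with the norm of \<open>H\<^bsup>s+\<delta>\<^esup>\<close>. This is a geometric series, so the sum of all terms is
  integrable and therefore finite almost everywhere.

  To identify the limits, and to know that the pieces and their translates are transforms of
  functions to which the maximal estimate applies, the \<open>L\<^sup>2\<close> theory of the Fourier transform is
  needed. It rests on two facts. The transform is bounded, by \<open>\<parallel>Ff\<parallel>\<^sup>2 \<le> 2\<pi> \<parallel>f\<parallel>\<^sup>2\<close> for the \<open>L\<^sup>2\<close> norm
  (\<open>energy_fourier_le\<close>), which gives existence by completeness (\<open>is_fourier_exists\<close>). And it is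
  injective on \<open>L\<^sup>1\<close>, by Levy's uniqueness theorem for characteristic functions. Testing against
  modulated Gaussians, whose transforms are explicit, reduces the inversion theorem
  (\<open>fourier_inversion\<close>) to this injectivity; surjectivity follows.
\<close>

section \<open>Square-integrable functions\<close>

text \<open>
  The squared \<open>L\<^sup>2\<close> norm. With values in \<open>[0, \<infinity>]\<close> it makes sense for every function, so that limits and
  Fatou's lemma can be used before square-integrability is known.
\<close>

definition energy :: "(real \<Rightarrow> complex) \<Rightarrow> ennreal" where
  "energy u = (\<integral>\<^sup>+ x. ennreal ((cmod (u x))\<^sup>2) \<partial>lebesgue)"

lemma L2_iff: "f \<in> L2 \<longleftrightarrow> f \<in> borel_measurable lebesgue \<and> energy f < \<infinity>"
  unfolding L2_def energy_def by (auto simp: integrable_iff_bounded)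

lemma L2_measurable: "f \<in> L2 \<Longrightarrow> f \<in> borel_measurable lebesgue"
  by (simp add: L2_def)

lemma energy_cong_AE:
  assumes "AE x in lebesgue. u x = v x"
  shows "energy u = energy v"
  unfolding energy_def using assms by (intro nn_integral_cong_AE) auto

lemma sq_norm_add_le: "(cmod (a + b))\<^sup>2 \<le> 2 * (cmod a)\<^sup>2 + 2 * (cmod b)\<^sup>2"
proof -
  have "(cmod (a + b))\<^sup>2 \<le> (cmod a + cmod b)\<^sup>2"
    by (intro power_mono norm_triangle_ineq) auto
  also have "\<dots> \<le> 2 * (cmod a)\<^sup>2 + 2 * (cmod b)\<^sup>2"
    using sum_squares_bound[of "cmod a" "cmod b"] by (simp add: power2_sum)
  finally show ?thesis .
qed

text \<open>
  A substitute for the triangle inequality. The factor \<open>2\<close> is harmless because energies are only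
  shown to be finite or to tend to zero.
\<close>

lemma energy_add_le:
  assumes [measurable]: "u \<in> borel_measurable lebesgue" "v \<in> borel_measurable lebesgue"
  shows "energy (\<lambda>x. u x + v x) \<le> 2 * energy u + 2 * energy v"
proof -
  have "energy (\<lambda>x. u x + v x)
      \<le> (\<integral>\<^sup>+ x. 2 * ennreal ((cmod (u x))\<^sup>2) + 2 * ennreal ((cmod (v x))\<^sup>2) \<partial>lebesgue)"
    unfolding energy_def
    using sq_norm_add_le
    by (intro nn_integral_mono)
      (simp add: ennreal_mult'[symmetric] ennreal_plus[symmetric] ennreal_leI
        flip: ennreal_numeral del: ennreal_plus)
  also have "\<dots> = 2 * energy u + 2 * energy v"
    unfolding energy_def by (simp add: nn_integral_add nn_integral_cmult)
  finally show ?thesis .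
qed

lemma energy_cmult:
  assumes [measurable]: "u \<in> borel_measurable lebesgue"
  shows "energy (\<lambda>x. c * u x) = ennreal ((cmod c)\<^sup>2) * energy u"
  unfolding energy_def
  by (simp add: norm_mult power_mult_distrib ennreal_mult nn_integral_cmult)

lemma energy_minus: "energy (\<lambda>x. u x - v x) = energy (\<lambda>x. v x - u x)"
  unfolding energy_def by (simp add: norm_minus_commute)

lemma energy_cnj: "energy (\<lambda>x. cnj (u x)) = energy u"
  unfolding energy_def by simp

lemma energy_diff_le:
  assumes [measurable]: "u \<in> borel_measurable lebesgue" "v \<in> borel_measurable lebesgue"
    "w \<in> borel_measurable lebesgue"
  shows "energy (\<lambda>x. u x - v x) \<le> 2 * energy (\<lambda>x. u x - w x) + 2 * energy (\<lambda>x. w x - v x)"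
  using energy_add_le[of "\<lambda>x. u x - w x" "\<lambda>x. w x - v x"] by simp

lemma energy_eq_0_iff:
  assumes [measurable]: "u \<in> borel_measurable lebesgue"
  shows "energy u = 0 \<longleftrightarrow> (AE x in lebesgue. u x = 0)"
  unfolding energy_def by (subst nn_integral_0_iff_AE) auto

lemma energy_mult_le:
  assumes "\<And>x. cmod (m x) \<le> B" "u \<in> borel_measurable lebesgue"
  shows "energy (\<lambda>x. m x * u x) \<le> ennreal (B\<^sup>2) * energy u"
proof -
  have "energy (\<lambda>x. m x * u x) \<le> energy (\<lambda>x. complex_of_real B * u x)"
    unfolding energy_def norm_mult power_mult_distrib
    using assms(1) order_trans[OF norm_ge_zero assms(1)]
    by (intro nn_integral_mono ennreal_leI mult_right_mono power_mono) auto
  then show ?thesis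
    using energy_cmult[OF assms(2), of "complex_of_real B"] by simp
qed

lemma L2_diff:
  assumes "u \<in> L2" "v \<in> L2"
  shows "(\<lambda>x. u x - v x) \<in> L2"
proof -
  have "energy (\<lambda>x. u x + (-1) * v x) \<le> 2 * energy u + 2 * energy (\<lambda>x. (-1) * v x)"
    using assms by (intro energy_add_le) (auto simp: L2_iff)
  also have "\<dots> < \<infinity>"
    using assms energy_cmult[of v "-1"] by (auto simp: L2_iff ennreal_mult_less_top)
  finally show ?thesis using assms by (auto simp: L2_iff)
qed

lemma L2_mult_bounded:
  assumes "\<And>x. cmod (m x) \<le> B" "m \<in> borel_measurable lebesgue" "u \<in> L2"
  shows "(\<lambda>x. m x * u x) \<in> L2"
proof -
  have "energy (\<lambda>x. m x * u x) \<le> ennreal (B\<^sup>2) * energy u"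
    using assms by (intro energy_mult_le) (auto simp: L2_iff)
  also have "\<dots> < \<infinity>" using assms by (auto simp: L2_iff ennreal_mult_less_top)
  finally show ?thesis using assms by (auto simp: L2_iff)
qed

lemma L2_cmult: "u \<in> L2 \<Longrightarrow> (\<lambda>x. c * u x) \<in> L2"
  by (rule L2_mult_bounded[where B = "cmod c"]) auto

lemma cnj_measurable [measurable]: "cnj \<in> borel_measurable borel"
  by (intro borel_measurable_continuous_onI continuous_intros)

lemma L2_cnj: "u \<in> L2 \<Longrightarrow> (\<lambda>x. cnj (u x)) \<in> L2"
  using measurable_compose[OF _ cnj_measurable] by (auto simp: L2_iff energy_cnj)

lemma bounded_integrable_L2:
  assumes "integrable lebesgue u" "\<And>x. cmod (u x) \<le> B"
  shows "u \<in> L2"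
proof -
  have [measurable]: "u \<in> borel_measurable lebesgue" using assms(1) by auto
  have "integrable lebesgue (\<lambda>x. (cmod (u x))\<^sup>2)"
  proof (rule Bochner_Integration.integrable_bound)
    show "integrable lebesgue (\<lambda>x. B * cmod (u x))"
      using assms(1) by (intro integrable_mult_right integrable_norm)
    show "AE x in lebesgue. norm ((cmod (u x))\<^sup>2) \<le> norm (B * cmod (u x))"
      using assms(2) order_trans[OF norm_ge_zero assms(2)]
      by (auto simp: power2_eq_square intro!: mult_right_mono)
  qed simp
  then show ?thesis by (simp add: L2_def)
qed

lemma L2_mult_integrable:
  assumes "u \<in> L2" "v \<in> L2"
  shows "integrable lebesgue (\<lambda>x. u x * v x)"
proof (rule Bochner_Integration.integrable_bound)
  show "integrable lebesgue (\<lambda>x. (cmod (u x))\<^sup>2 + (cmod (v x))\<^sup>2)"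
    using assms unfolding L2_def by auto
  show "(\<lambda>x. u x * v x) \<in> borel_measurable lebesgue"
    using assms unfolding L2_def by auto
  show "AE x in lebesgue. norm (u x * v x) \<le> norm ((cmod (u x))\<^sup>2 + (cmod (v x))\<^sup>2)"
  proof (rule AE_I2)
    fix x :: real
    have "2 * (cmod (u x) * cmod (v x)) \<le> (cmod (u x))\<^sup>2 + (cmod (v x))\<^sup>2"
      using sum_squares_bound[of "cmod (u x)" "cmod (v x)"] by simp
    moreover have "0 \<le> cmod (u x) * cmod (v x)" by simp
    ultimately show "norm (u x * v x) \<le> norm ((cmod (u x))\<^sup>2 + (cmod (v x))\<^sup>2)"
      unfolding norm_mult real_norm_def abs_of_nonneg[OF add_nonneg_nonneg[OF zero_le_power2 zero_le_power2]]
      by linarith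
  qed
qed

lemma ennreal_tendsto_mult_const:
  fixes f :: "'a \<Rightarrow> ennreal"
  assumes "c < top" "(f \<longlongrightarrow> x) F"
  shows "((\<lambda>y. f y * c) \<longlongrightarrow> x * c) F"
  using ennreal_tendsto_cmult[OF assms] by (simp add: mult.commute)

lemma L2_Cauchy_Schwarz:
  assumes "u \<in> L2" "v \<in> L2"
  shows "ennreal ((LINT x|lebesgue. cmod (u x * v x))\<^sup>2) \<le> energy u * energy v"
proof -
  have [measurable]: "u \<in> borel_measurable lebesgue" "v \<in> borel_measurable lebesgue"
    using assms by (auto simp: L2_def)
  have "ennreal (LINT x|lebesgue. cmod (u x * v x))
      = (\<integral>\<^sup>+ x. ennreal (cmod (u x)) * ennreal (cmod (v x)) \<partial>lebesgue)"
    using nn_integral_eq_integral[OF integrable_norm[OF L2_mult_integrable[OF assms]]]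
    by (simp add: norm_mult ennreal_mult)
  then have "(ennreal (LINT x|lebesgue. cmod (u x * v x)))\<^sup>2 \<le> energy u * energy v"
    unfolding energy_def using Cauchy_Schwarz_nn_integral[of "\<lambda>x. ennreal (cmod (u x))" lebesgue "\<lambda>x. ennreal (cmod (v x))"]
    by (simp add: ennreal_power)
  then show ?thesis by (simp add: ennreal_power integral_nonneg)
qed

text \<open>
  Convergence in \<open>L\<^sup>2\<close> implies weak convergence, by the Cauchy-Schwarz inequality.
\<close>

lemma energy_tendsto_integral_tendsto:
  assumes u: "\<And>n. u n \<in> L2" "v \<in> L2" and lim: "(\<lambda>n. energy (\<lambda>x. u n x - v x)) \<longlonglongrightarrow> 0"
    and \<phi>: "\<phi> \<in> L2"
  shows "(\<lambda>n. LINT x|lebesgue. u n x * \<phi> x) \<longlonglongrightarrow> (LINT x|lebesgue. v x * \<phi> x)"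
proof -
  have *: "ennreal ((cmod ((LINT x|lebesgue. u n x * \<phi> x) - (LINT x|lebesgue. v x * \<phi> x)))\<^sup>2)
       \<le> energy (\<lambda>x. u n x - v x) * energy \<phi>" for n
  proof -
    have "(LINT x|lebesgue. u n x * \<phi> x) - (LINT x|lebesgue. v x * \<phi> x) = (LINT x|lebesgue. (u n x - v x) * \<phi> x)"
      unfolding left_diff_distrib using u \<phi>
      by (intro Bochner_Integration.integral_diff[symmetric] L2_mult_integrable) auto
    then have "cmod ((LINT x|lebesgue. u n x * \<phi> x) - (LINT x|lebesgue. v x * \<phi> x))
        \<le> (LINT x|lebesgue. cmod ((u n x - v x) * \<phi> x))"
      by (simp only: integral_norm_bound)
    then have "ennreal ((cmod ((LINT x|lebesgue. u n x * \<phi> x) - (LINT x|lebesgue. v x * \<phi> x)))\<^sup>2)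
        \<le> ennreal ((LINT x|lebesgue. cmod ((u n x - v x) * \<phi> x))\<^sup>2)"
      by (intro ennreal_leI power_mono) auto
    also have "\<dots> \<le> energy (\<lambda>x. u n x - v x) * energy \<phi>"
      by (intro L2_Cauchy_Schwarz L2_diff u \<phi>)
    finally show ?thesis .
  qed
  have L: "(\<lambda>n. energy (\<lambda>x. u n x - v x) * energy \<phi>) \<longlonglongrightarrow> 0 * energy \<phi>"
    using \<phi> lim by (intro ennreal_tendsto_mult_const) (auto simp: L2_iff)
  have "(\<lambda>n. ennreal ((cmod ((LINT x|lebesgue. u n x * \<phi> x) - (LINT x|lebesgue. v x * \<phi> x)))\<^sup>2)) \<longlonglongrightarrow> 0"
    by (rule tendsto_sandwich[where f = "\<lambda>_. 0" and h = "\<lambda>n. energy (\<lambda>x. u n x - v x) * energy \<phi>"])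
      (use * L in auto)
  then have "(\<lambda>n. (cmod ((LINT x|lebesgue. u n x * \<phi> x) - (LINT x|lebesgue. v x * \<phi> x)))\<^sup>2) \<longlonglongrightarrow> 0"
    unfolding ennreal_0[symmetric] by (subst (asm) tendsto_ennreal_iff) auto
  from tendsto_real_sqrt[OF this]
  have "(\<lambda>n. cmod ((LINT x|lebesgue. u n x * \<phi> x) - (LINT x|lebesgue. v x * \<phi> x))) \<longlonglongrightarrow> 0"
    by simp
  then have "(\<lambda>n. (LINT x|lebesgue. u n x * \<phi> x) - (LINT x|lebesgue. v x * \<phi> x)) \<longlonglongrightarrow> 0"
    by (rule tendsto_norm_zero_cancel)
  then show ?thesis by (simp add: LIM_zero_iff)
qed

text \<open>
  Convergence in \<open>L\<^sup>2\<close> is convergence of the squared differences in \<open>L\<^sup>1\<close>, for which almost everywhere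
  convergent subsequences exist.
\<close>

lemma energy_tendsto_AE_subseq:
  assumes u: "\<And>n. u n \<in> L2" "v \<in> L2" and lim: "(\<lambda>n. energy (\<lambda>x. u n x - v x)) \<longlonglongrightarrow> 0"
  obtains r :: "nat \<Rightarrow> nat" where "strict_mono r" "AE x in lebesgue. (\<lambda>n. u (r n) x) \<longlonglongrightarrow> v x"
proof -
  let ?d = "\<lambda>n x. (cmod (u n x - v x))\<^sup>2"
  have int: "integrable lebesgue (?d n)" for n using L2_diff[OF u(1) u(2), of n] by (simp add: L2_def)
  have "energy (\<lambda>x. u n x - v x) = ennreal (LINT x|lebesgue. norm (?d n x))" for n
    unfolding energy_def using int by (subst nn_integral_eq_integral) auto
  then have "(\<lambda>n. ennreal (LINT x|lebesgue. norm (?d n x))) \<longlonglongrightarrow> ennreal 0" using lim by simp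
  then have "(\<lambda>n. LINT x|lebesgue. norm (?d n x)) \<longlonglongrightarrow> 0"
    by (subst (asm) tendsto_ennreal_iff) auto
  from tendsto_L1_AE_subseq[OF int this]
  obtain r where r: "strict_mono r" "AE x in lebesgue. (\<lambda>n. ?d (r n) x) \<longlonglongrightarrow> 0" by auto
  from r(2) have "AE x in lebesgue. (\<lambda>n. u (r n) x) \<longlonglongrightarrow> v x"
  proof eventually_elim
    case (elim x)
    from tendsto_real_sqrt[OF this] have "(\<lambda>n. cmod (u (r n) x - v x)) \<longlonglongrightarrow> 0" by simp
    then have "(\<lambda>n. u (r n) x - v x) \<longlonglongrightarrow> 0" by (rule tendsto_norm_zero_cancel)
    then show ?case by (simp add: LIM_zero_iff)
  qed
  with r(1) show ?thesis by (rule that)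
qed

section \<open>The Fourier integral of an integrable function\<close>

text \<open>
  This makes Fubini's theorem available for functions that are Lebesgue, but not Borel, measurable.
\<close>

lemma sigma_finite_lebesgue: "sigma_finite_measure (lebesgue :: real measure)"
proof -
  obtain A :: "real set set" where A: "countable A" "A \<subseteq> sets lborel" "\<Union>A = space lborel"
    "\<forall>a\<in>A. emeasure lborel a \<noteq> \<infinity>"
    using sigma_finite_measure.sigma_finite_countable[OF sigma_finite_lborel] by blast
  show ?thesis
    by standard (rule exI[of _ A], use A in auto)
qed

interpretation leb: sigma_finite_measure "lebesgue :: real measure"
  by (rule sigma_finite_lebesgue)

interpretation leb2: pair_sigma_finite "lebesgue :: real measure" "lebesgue :: real measure"
  by standard

lemma ident_lebesgue_measurable [measurable]: "(\<lambda>x::real. x) \<in> borel_measurable lebesgue"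
  by (rule measurable_completion) simp

lemma fst_lebesgue_measurable [measurable]: "fst \<in> borel_measurable ((lebesgue :: real measure) \<Otimes>\<^sub>M (lebesgue :: real measure))"
  using measurable_compose[OF measurable_fst ident_lebesgue_measurable] by simp

lemma snd_lebesgue_measurable [measurable]: "snd \<in> borel_measurable ((lebesgue :: real measure) \<Otimes>\<^sub>M (lebesgue :: real measure))"
  using measurable_compose[OF measurable_snd ident_lebesgue_measurable] by simp

lemma integrable_character:
  assumes "integrable lebesgue f"
  shows "integrable lebesgue (\<lambda>x. exp (- \<i> * complex_of_real (x * \<xi>)) * f x)"
proof (rule Bochner_Integration.integrable_bound[OF assms])
  have [measurable]: "f \<in> borel_measurable lebesgue" using assms by auto
  have [measurable]: "(\<lambda>x. exp (- \<i> * complex_of_real (x * \<xi>))) \<in> borel_measurable lebesgue"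
    by measurable
  show "(\<lambda>x. exp (- \<i> * complex_of_real (x * \<xi>)) * f x) \<in> borel_measurable lebesgue"
    by measurable
qed (auto simp: norm_mult)

lemma fourier_integral_modulate:
  "fourier_integral (\<lambda>x. exp (\<i> * complex_of_real (\<theta> * x)) * f x) \<xi> = fourier_integral f (\<xi> - \<theta>)"
proof -
  have "exp (- \<i> * complex_of_real (x * \<xi>)) * exp (\<i> * complex_of_real (\<theta> * x))
      = exp (- \<i> * complex_of_real (x * (\<xi> - \<theta>)))" for x
    by (simp add: exp_add[symmetric] algebra_simps)
  then show ?thesis
    unfolding fourier_integral_def by (simp only: mult.assoc[symmetric])
qed

lemma fourier_integral_cnj: "fourier_integral (\<lambda>x. cnj (f x)) \<xi> = cnj (fourier_integral f (- \<xi>))"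
proof -
  have "exp (- \<i> * complex_of_real (x * \<xi>)) * cnj (f x) = cnj (exp (- \<i> * complex_of_real (x * (- \<xi>))) * f x)" for x
    by (simp add: exp_cnj)
  then show ?thesis unfolding fourier_integral_def
    by (simp only: Bochner_Integration.integral_cnj)
qed

lemma fourier_integral_cmult:
  "fourier_integral (\<lambda>x. c * f x) \<xi> = c * fourier_integral f \<xi>"
  unfolding fourier_integral_def by (simp add: mult.left_commute)

lemma fourier_integral_add:
  assumes "integrable lebesgue f" "integrable lebesgue g"
  shows "fourier_integral (\<lambda>x. f x + g x) \<xi> = fourier_integral f \<xi> + fourier_integral g \<xi>"
  unfolding fourier_integral_def distrib_left
  by (rule Bochner_Integration.integral_add[OF integrable_character[OF assms(1)] integrable_character[OF assms(2)]])

lemma fourier_integral_diff: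
  assumes "integrable lebesgue f" "integrable lebesgue g"
  shows "fourier_integral (\<lambda>x. f x - g x) \<xi> = fourier_integral f \<xi> - fourier_integral g \<xi>"
  unfolding fourier_integral_def right_diff_distrib
  by (rule Bochner_Integration.integral_diff[OF integrable_character[OF assms(1)] integrable_character[OF assms(2)]])

lemma fourier_integral_measurable:
  assumes [measurable]: "f \<in> borel_measurable lebesgue"
  shows "fourier_integral f \<in> borel_measurable lebesgue"
proof -
  have [measurable]: "(\<lambda>p. exp (- \<i> * complex_of_real (snd p * fst p))) \<in>
      borel_measurable ((lebesgue :: real measure) \<Otimes>\<^sub>M (lebesgue :: real measure))"
    by measurable
  have "(\<lambda>\<xi>. LINT x|lebesgue. exp (- \<i> * complex_of_real (x * \<xi>)) * f x) \<in> borel_measurable lebesgue"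
    by (rule leb.borel_measurable_lebesgue_integral) (simp add: split_beta')
  then show ?thesis by (simp add: fourier_integral_def[abs_def])
qed

text \<open>
  The multiplication formula: both sides are the iterated integrals of \<open>exp (-i x \<xi>) f(x) g(\<xi>)\<close>.
\<close>

lemma fourier_integral_mult:
  assumes f: "integrable lebesgue f" and g: "integrable lebesgue g"
  shows "(LINT \<xi>|lebesgue. fourier_integral f \<xi> * g \<xi>) = (LINT x|lebesgue. f x * fourier_integral g x)"
proof -
  have [measurable]: "f \<in> borel_measurable lebesgue" "g \<in> borel_measurable lebesgue"
    using assms by auto
  define H where "H = (\<lambda>x \<xi>. exp (- \<i> * complex_of_real (x * \<xi>)) * f x * g \<xi>)"
  have meas: "(\<lambda>(x, \<xi>). H x \<xi>) \<in> borel_measurable (lebesgue \<Otimes>\<^sub>M lebesgue)"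
  proof -
    have [measurable]: "(\<lambda>p. exp (- \<i> * complex_of_real (fst p * snd p))) \<in>
      borel_measurable ((lebesgue :: real measure) \<Otimes>\<^sub>M (lebesgue :: real measure))"
      by measurable
    show ?thesis unfolding H_def split_beta' by measurable
  qed
  have int: "integrable (lebesgue \<Otimes>\<^sub>M lebesgue) (\<lambda>(x, \<xi>). H x \<xi>)"
  proof (rule leb2.Fubini_integrable[OF meas])
    have "integrable lebesgue (\<lambda>x. cmod (f x) * (LINT \<xi>|lebesgue. cmod (g \<xi>)))"
      using f by (intro integrable_mult_left integrable_norm)
    then show "integrable lebesgue (\<lambda>x. LINT y|lebesgue. norm (case (x, y) of (x, \<xi>) \<Rightarrow> H x \<xi>))"
      by (simp add: H_def norm_mult)
    have "integrable lebesgue (\<lambda>y. H x y)" for x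
      unfolding H_def using integrable_mult_right[OF integrable_character[OF g, of x], of "f x"]
      by (simp add: mult_ac)
    then show "AE x in lebesgue. integrable lebesgue (\<lambda>y. case (x, y) of (x, \<xi>) \<Rightarrow> H x \<xi>)"
      by simp
  qed
  have "(LINT \<xi>|lebesgue. fourier_integral f \<xi> * g \<xi>) = (LINT \<xi>|lebesgue. LINT x|lebesgue. H x \<xi>)"
    unfolding fourier_integral_def H_def by simp
  also have "\<dots> = (LINT x|lebesgue. LINT \<xi>|lebesgue. H x \<xi>)"
    by (rule leb2.Fubini_integral[OF int])
  also have "\<dots> = (LINT x|lebesgue. f x * fourier_integral g x)"
    unfolding fourier_integral_def H_def by (simp flip: integral_mult_right_zero add: mult_ac)
  finally show ?thesis .
qed

lemma fourier_integral_lborel: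
  assumes [measurable]: "f \<in> borel_measurable borel"
  shows "fourier_integral f \<xi> = (LINT x|lborel. exp (- \<i> * complex_of_real (x * \<xi>)) * f x)"
  unfolding fourier_integral_def by (intro integral_completion) simp

lemma fourier_integral_translate:
  assumes [measurable]: "f \<in> borel_measurable borel"
  shows "fourier_integral (\<lambda>x. f (x - \<theta>)) \<xi> = exp (- \<i> * complex_of_real (\<theta> * \<xi>)) * fourier_integral f \<xi>"
proof -
  have "fourier_integral (\<lambda>x. f (x - \<theta>)) \<xi>
      = (LINT x|lborel. exp (- \<i> * complex_of_real ((\<theta> + 1 * x) * \<xi>)) * f ((\<theta> + 1 * x) - \<theta>))"
    by (subst fourier_integral_lborel, simp, subst lborel_integral_real_affine[of 1 _ \<theta>]) auto
  also have "\<dots> = (LINT x|lborel. exp (- \<i> * complex_of_real (\<theta> * \<xi>)) * (exp (- \<i> * complex_of_real (x * \<xi>)) * f x))"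
  proof -
    have "exp (- \<i> * complex_of_real ((\<theta> + 1 * x) * \<xi>))
        = exp (- \<i> * complex_of_real (\<theta> * \<xi>)) * exp (- \<i> * complex_of_real (x * \<xi>))" for x
      by (simp add: exp_add[symmetric] algebra_simps)
    then show ?thesis by (simp add: mult.assoc)
  qed
  finally show ?thesis by (simp add: fourier_integral_lborel)
qed

lemma fourier_integral_scale:
  assumes [measurable]: "f \<in> borel_measurable borel" and c: "c > 0"
  shows "fourier_integral (\<lambda>x. f (c * x)) \<xi> = fourier_integral f (\<xi> / c) / c"
proof -
  have "fourier_integral f (\<xi> / c)
      = c *\<^sub>R (LINT x|lborel. exp (- \<i> * complex_of_real ((0 + c * x) * (\<xi> / c))) * f (0 + c * x))"
    by (subst fourier_integral_lborel, simp, subst lborel_integral_real_affine[of c _ 0])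
      (use c in auto)
  also have "\<dots> = c *\<^sub>R (LINT x|lborel. exp (- \<i> * complex_of_real (x * \<xi>)) * f (c * x))"
    using c by (intro arg_cong[where f="\<lambda>z. c *\<^sub>R z"] Bochner_Integration.integral_cong) auto
  finally show ?thesis using c by (simp add: fourier_integral_lborel scaleR_conv_of_real)
qed

section \<open>Gaussians\<close>

text \<open>
  Complex-valued and normalised so that \<open>gaussian\<close> is an eigenfunction of the Fourier integral.
\<close>

definition gaussian :: "real \<Rightarrow> complex" where
  "gaussian x = complex_of_real (exp (- x\<^sup>2 / 2))"

lemma gaussian_measurable [measurable]: "gaussian \<in> borel_measurable borel"
  unfolding gaussian_def[abs_def] by simp

lemma gaussian_density: "exp (- x\<^sup>2 / 2) = sqrt (2 * pi) * std_normal_density x"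
  by (simp add: std_normal_density_def)

text \<open>
  This is the known characteristic function of the standard normal distribution.
\<close>

lemma fourier_gaussian: "fourier_integral gaussian \<xi> = complex_of_real (sqrt (2 * pi)) * gaussian \<xi>"
proof -
  have "char std_normal_distribution (- \<xi>)
     = (LINT x|lborel. std_normal_density x *\<^sub>R exp (\<i> * complex_of_real ((- \<xi>) * x)))"
    unfolding char_def by (subst integral_density) auto
  also have "\<dots> = (LINT x|lborel. complex_of_real (1 / sqrt (2 * pi)) * (exp (- \<i> * complex_of_real (x * \<xi>)) * gaussian x))"
    by (intro Bochner_Integration.integral_cong)
      (auto simp: gaussian_def std_normal_density_def scaleR_conv_of_real mult_ac)
  also have "\<dots> = complex_of_real (1 / sqrt (2 * pi)) * fourier_integral gaussian \<xi>"
    by (simp add: fourier_integral_lborel)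
  finally have "gaussian \<xi> = complex_of_real (1 / sqrt (2 * pi)) * fourier_integral gaussian \<xi>"
    by (simp add: char_std_normal_distribution gaussian_def)
  then show ?thesis by (simp add: field_simps flip: of_real_mult)
qed

lemma gaussian_integrable: "integrable lebesgue gaussian"
proof -
  have "integrable lborel (\<lambda>x. sqrt (2 * pi) * std_normal_density x)"
    by (intro integrable_mult_right) simp
  then have "integrable lborel (\<lambda>x. complex_of_real (exp (- x\<^sup>2 / 2)))"
    unfolding gaussian_density by (intro integrable_of_real)
  then show ?thesis by (simp add: gaussian_def[abs_def] integrable_completion)
qed

lemma gaussian_translate_integrable: "integrable lebesgue (\<lambda>x. gaussian (x - \<theta>))"
proof -
  have "integrable lborel (\<lambda>x. gaussian (- \<theta> + 1 * x))"
    using gaussian_integrable by (intro lborel_integrable_real_affine) (auto simp: integrable_completion)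
  then show ?thesis by (simp add: integrable_completion)
qed

lemma gaussian_scale_integrable:
  assumes "c > 0"
  shows "integrable lebesgue (\<lambda>x. gaussian (c * x))"
proof -
  have "integrable lborel (\<lambda>x. gaussian (0 + c * x))"
    using gaussian_integrable assms by (intro lborel_integrable_real_affine) (auto simp: integrable_completion)
  then show ?thesis by (simp add: integrable_completion)
qed

lemma norm_gaussian_le: "cmod (gaussian x) \<le> 1"
  by (simp add: gaussian_def)

lemma gaussian_L2: "gaussian \<in> L2"
  by (rule bounded_integrable_L2[OF gaussian_integrable norm_gaussian_le])

lemma gaussian_translate_L2: "(\<lambda>x. gaussian (x - \<theta>)) \<in> L2"
  by (rule bounded_integrable_L2[OF gaussian_translate_integrable norm_gaussian_le])

lemma gaussian_modulate_integrable:
  "integrable lebesgue (\<lambda>x. exp (\<i> * complex_of_real (\<theta> * x)) * gaussian x)"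
  using integrable_character[OF gaussian_integrable, of "- \<theta>"] by (simp add: mult_ac)

lemma gaussian_modulate_L2: "(\<lambda>x. exp (\<i> * complex_of_real (\<theta> * x)) * gaussian x) \<in> L2"
  by (rule bounded_integrable_L2[OF gaussian_modulate_integrable, of _ 1])
    (simp add: norm_mult norm_gaussian_le)

lemma fourier_gaussian_scale:
  assumes "c > 0"
  shows "fourier_integral (\<lambda>x. gaussian (c * x)) \<xi> = complex_of_real (2 * pi * normal_density 0 c \<xi>)"
proof -
  have "2 * pi * normal_density 0 c \<xi> = sqrt (2 * pi) * exp (- (\<xi> / c)\<^sup>2 / 2) / c"
    using assms by (simp add: normal_density_def real_sqrt_mult power_divide field_simps)
  then show ?thesis
    by (simp only: fourier_integral_scale[OF gaussian_measurable assms] fourier_gaussian)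
      (simp add: gaussian_def)
qed

lemma nn_integral_normal_density:
  assumes "c > 0"
  shows "(\<integral>\<^sup>+ x. ennreal (normal_density \<mu> c x) \<partial>lebesgue) = 1"
  using assms by (simp add: nn_integral_completion nn_integral_eq_integral)

section \<open>The \<open>L\<^sup>2\<close> bound for the Fourier integral\<close>

text \<open>
  By the multiplication formula the left-hand side is the double integral of \<open>f(x) cnj(f(y)) K(x, y)\<close>,
  where the kernel \<open>K\<close> is the transform of the Gaussian weight at \<open>y - x\<close>. The kernel is nonnegative,
  symmetric and has total mass \<open>2\<pi>\<close> in each variable, so \<open>\<bar>f(x) f(y)\<bar> \<le> (\<bar>f(x)\<bar>\<^sup>2 + \<bar>f(y)\<bar>\<^sup>2) / 2\<close> suffices.
\<close>

lemma energy_fourier_smoothed_le: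
  assumes f: "integrable lebesgue f" and c: "c > 0"
  shows "(\<integral>\<^sup>+ \<xi>. ennreal ((cmod (fourier_integral f \<xi>))\<^sup>2 * cmod (gaussian (c * \<xi>))) \<partial>lebesgue)
     \<le> ennreal (2 * pi) * energy f"
proof -
  have [measurable]: "f \<in> borel_measurable lebesgue" using f by auto
  have [measurable]: "fourier_integral f \<in> borel_measurable lebesgue"
    by (rule fourier_integral_measurable) simp
  have [measurable]: "gaussian \<in> borel_measurable lebesgue" "(\<lambda>x. gaussian (c * x)) \<in> borel_measurable lebesgue"
    using gaussian_integrable gaussian_scale_integrable[OF c] by auto
  have gpos: "complex_of_real (cmod (gaussian x)) = gaussian x" for x by (simp add: gaussian_def)
  define B where "B = (LINT x|lebesgue. cmod (f x))"
  have B: "cmod (fourier_integral f \<xi>) \<le> B" for \<xi>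
  proof -
    have "cmod (fourier_integral f \<xi>) \<le> (LINT x|lebesgue. cmod (exp (- \<i> * complex_of_real (x * \<xi>)) * f x))"
      unfolding fourier_integral_def by (rule integral_norm_bound)
    then show ?thesis by (simp add: B_def norm_mult)
  qed
  define K where "K = (\<lambda>x y. 2 * pi * normal_density x c y)"
  have K0: "0 \<le> K x y" for x y by (simp add: K_def)
  have Ksym: "K x y = K y x" for x y
    by (simp add: K_def normal_density_def power2_commute)
  have K1: "(\<integral>\<^sup>+ y. ennreal (K x y) \<partial>lebesgue) = ennreal (2 * pi)" for x
    unfolding K_def using nn_integral_normal_density[OF c, of x]
    by (simp add: ennreal_mult nn_integral_cmult)
  have K2: "(\<integral>\<^sup>+ x. ennreal (K x y) \<partial>lebesgue) = ennreal (2 * pi)" for y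
    using K1[of y] by (simp add: Ksym)
  have [measurable]: "(\<lambda>p. K (fst p) (snd p)) \<in> borel_measurable ((lebesgue :: real measure) \<Otimes>\<^sub>M (lebesgue :: real measure))"
    unfolding K_def normal_density_def by measurable
  have [measurable]: "(\<lambda>y. K x y) \<in> borel_measurable lebesgue" "(\<lambda>y. K y x) \<in> borel_measurable lebesgue" for x
    unfolding K_def normal_density_def by measurable
  let ?g = "\<lambda>\<xi>. cnj (fourier_integral f \<xi>) * gaussian (c * \<xi>)"
  have g: "integrable lebesgue ?g"
  proof (rule Bochner_Integration.integrable_bound)
    show "integrable lebesgue (\<lambda>x. B * cmod (gaussian (c * x)))"
      using gaussian_scale_integrable[OF c] by (intro integrable_mult_right integrable_norm)
    show "AE x in lebesgue. norm (?g x) \<le> norm (B * cmod (gaussian (c * x)))"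
      using B order_trans[OF norm_ge_zero B] by (auto simp: norm_mult intro!: mult_right_mono)
  qed simp
  have Fg: "fourier_integral ?g x = cnj (LINT y|lebesgue. f y * complex_of_real (K x y))" for x
  proof -
    have mod_int: "integrable lebesgue (\<lambda>\<xi>. exp (\<i> * complex_of_real (x * \<xi>)) * gaussian (c * \<xi>))"
      using integrable_character[OF gaussian_scale_integrable[OF c], of "- x"] by (simp add: mult_ac)
    have "fourier_integral ?g x =
        (LINT \<xi>|lebesgue. cnj (fourier_integral f \<xi> * (exp (\<i> * complex_of_real (x * \<xi>)) * gaussian (c * \<xi>))))"
      unfolding fourier_integral_def[of _ x]
      by (intro Bochner_Integration.integral_cong) (auto simp: exp_cnj gaussian_def mult_ac)
    also have "\<dots> = cnj (LINT \<xi>|lebesgue. fourier_integral f \<xi> * (exp (\<i> * complex_of_real (x * \<xi>)) * gaussian (c * \<xi>)))"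
      by (rule Bochner_Integration.integral_cnj)
    also have "\<dots> = cnj (LINT y|lebesgue. f y * fourier_integral (\<lambda>\<xi>. exp (\<i> * complex_of_real (x * \<xi>)) * gaussian (c * \<xi>)) y)"
      by (subst fourier_integral_mult[OF f mod_int]) simp
    also have "\<dots> = cnj (LINT y|lebesgue. f y * complex_of_real (K x y))"
      by (simp only: fourier_integral_modulate fourier_gaussian_scale[OF c])
        (simp only: K_def normal_density_def diff_0_right)
    finally show ?thesis .
  qed
  have cint: "integrable lebesgue (\<lambda>\<xi>. (cmod (fourier_integral f \<xi>))\<^sup>2 * cmod (gaussian (c * \<xi>)))"
  proof (rule Bochner_Integration.integrable_bound)
    show "integrable lebesgue (\<lambda>x. B\<^sup>2 * cmod (gaussian (c * x)))"
      using gaussian_scale_integrable[OF c] by (intro integrable_mult_right integrable_norm)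
    show "AE x in lebesgue. norm ((cmod (fourier_integral f x))\<^sup>2 * cmod (gaussian (c * x))) \<le> norm (B\<^sup>2 * cmod (gaussian (c * x)))"
      using B by (auto simp: norm_mult intro!: mult_right_mono power_mono)
  qed simp
  have "(\<integral>\<^sup>+ \<xi>. ennreal ((cmod (fourier_integral f \<xi>))\<^sup>2 * cmod (gaussian (c * \<xi>))) \<partial>lebesgue)
      = ennreal (LINT \<xi>|lebesgue. (cmod (fourier_integral f \<xi>))\<^sup>2 * cmod (gaussian (c * \<xi>)))"
    by (rule nn_integral_eq_integral[OF cint]) simp
  also have "\<dots> = ennreal (cmod (LINT \<xi>|lebesgue. fourier_integral f \<xi> * ?g \<xi>))"
  proof -
    have "(LINT \<xi>|lebesgue. fourier_integral f \<xi> * ?g \<xi>)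
        = (LINT \<xi>|lebesgue. complex_of_real ((cmod (fourier_integral f \<xi>))\<^sup>2 * cmod (gaussian (c * \<xi>))))"
      by (intro Bochner_Integration.integral_cong)
        (auto simp: gpos complex_norm_square simp del: of_real_power simp flip: mult.assoc)
    then show ?thesis
      by (simp only: integral_complex_of_real norm_of_real) (simp add: integral_nonneg)
  qed
  also have "\<dots> = ennreal (cmod (LINT x|lebesgue. f x * fourier_integral ?g x))"
    by (simp only: fourier_integral_mult[OF f g])
  also have "\<dots> \<le> (\<integral>\<^sup>+ x. ennreal (cmod (f x * fourier_integral ?g x)) \<partial>lebesgue)"
  proof (cases "integrable lebesgue (\<lambda>x. f x * fourier_integral ?g x)")
    case True then show ?thesis by (rule integral_norm_bound_ennreal)
  next
    case False then show ?thesis by (simp add: not_integrable_integral_eq)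
  qed
  also have "\<dots> \<le> (\<integral>\<^sup>+ x. (\<integral>\<^sup>+ y. ennreal (cmod (f x) * cmod (f y) * K x y) \<partial>lebesgue) \<partial>lebesgue)"
  proof (rule nn_integral_mono)
    fix x :: real
    have "ennreal (cmod (LINT y|lebesgue. f y * complex_of_real (K x y)))
       \<le> (\<integral>\<^sup>+ y. ennreal (cmod (f y * complex_of_real (K x y))) \<partial>lebesgue)"
    proof (cases "integrable lebesgue (\<lambda>y. f y * complex_of_real (K x y))")
      case True then show ?thesis by (rule integral_norm_bound_ennreal)
    next
      case False then show ?thesis by (simp add: not_integrable_integral_eq)
    qed
    then have "ennreal (cmod (f x)) * ennreal (cmod (LINT y|lebesgue. f y * complex_of_real (K x y)))
      \<le> ennreal (cmod (f x)) * (\<integral>\<^sup>+ y. ennreal (cmod (f y) * K x y) \<partial>lebesgue)"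
      using K0 by (intro mult_left_mono) (auto simp: norm_mult)
    also have "\<dots> = (\<integral>\<^sup>+ y. ennreal (cmod (f x) * cmod (f y) * K x y) \<partial>lebesgue)"
      using K0 by (subst nn_integral_cmult[symmetric]) (auto simp: ennreal_mult mult_ac)
    finally show "ennreal (cmod (f x * fourier_integral ?g x)) \<le> (\<integral>\<^sup>+ y. ennreal (cmod (f x) * cmod (f y) * K x y) \<partial>lebesgue)"
      by (simp add: Fg norm_mult ennreal_mult)
  qed
  also have "\<dots> \<le> (\<integral>\<^sup>+ x. (\<integral>\<^sup>+ y. ennreal ((cmod (f x))\<^sup>2 / 2) * ennreal (K x y) + ennreal ((cmod (f y))\<^sup>2 / 2) * ennreal (K x y) \<partial>lebesgue) \<partial>lebesgue)"
  proof (intro nn_integral_mono)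
    fix x y :: real
    have "cmod (f x) * cmod (f y) * K x y \<le> ((cmod (f x))\<^sup>2 / 2 + (cmod (f y))\<^sup>2 / 2) * K x y"
      using sum_squares_bound[of "cmod (f x)" "cmod (f y)"] by (intro mult_right_mono K0) auto
    then show "ennreal (cmod (f x) * cmod (f y) * K x y) \<le>
        ennreal ((cmod (f x))\<^sup>2 / 2) * ennreal (K x y) + ennreal ((cmod (f y))\<^sup>2 / 2) * ennreal (K x y)"
      using K0 by (simp add: ennreal_leI algebra_simps flip: ennreal_mult ennreal_plus)
  qed
  also have "\<dots> = (\<integral>\<^sup>+ x. ennreal ((cmod (f x))\<^sup>2 / 2) * ennreal (2 * pi) \<partial>lebesgue)
     + (\<integral>\<^sup>+ x. (\<integral>\<^sup>+ y. ennreal ((cmod (f y))\<^sup>2 / 2) * ennreal (K x y) \<partial>lebesgue) \<partial>lebesgue)"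
    by (simp add: nn_integral_add nn_integral_cmult K1)
  also have "(\<integral>\<^sup>+ x. (\<integral>\<^sup>+ y. ennreal ((cmod (f y))\<^sup>2 / 2) * ennreal (K x y) \<partial>lebesgue) \<partial>lebesgue)
     = (\<integral>\<^sup>+ y. (\<integral>\<^sup>+ x. ennreal ((cmod (f y))\<^sup>2 / 2) * ennreal (K x y) \<partial>lebesgue) \<partial>lebesgue)"
    by (rule leb2.Fubini'[symmetric]) (simp add: split_beta')
  also have "\<dots> = (\<integral>\<^sup>+ y. ennreal ((cmod (f y))\<^sup>2 / 2) * ennreal (2 * pi) \<partial>lebesgue)"
    by (simp add: nn_integral_cmult K2)
  also have "(\<integral>\<^sup>+ x. ennreal ((cmod (f x))\<^sup>2 / 2) * ennreal (2 * pi) \<partial>lebesgue) + (\<integral>\<^sup>+ y. ennreal ((cmod (f y))\<^sup>2 / 2) * ennreal (2 * pi) \<partial>lebesgue)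
     = (\<integral>\<^sup>+ x. ennreal ((cmod (f x))\<^sup>2 / 2) * ennreal (2 * pi) + ennreal ((cmod (f x))\<^sup>2 / 2) * ennreal (2 * pi) \<partial>lebesgue)"
    by (rule nn_integral_add[symmetric]) auto
  also have "\<dots> = (\<integral>\<^sup>+ x. ennreal (2 * pi) * ennreal ((cmod (f x))\<^sup>2) \<partial>lebesgue)"
    by (intro nn_integral_cong) (simp flip: ennreal_mult ennreal_plus add: field_simps)
  also have "\<dots> = ennreal (2 * pi) * energy f"
    unfolding energy_def by (rule nn_integral_cmult) simp
  finally show ?thesis .
qed

text \<open>
  One half of Plancherel's theorem: let the Gaussian weight increase to \<open>1\<close> and apply Fatou's lemma.
\<close>

lemma energy_fourier_le:
  assumes f: "integrable lebesgue f"
  shows "energy (fourier_integral f) \<le> ennreal (2 * pi) * energy f"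
proof -
  have [measurable]: "fourier_integral f \<in> borel_measurable lebesgue"
    using f by (intro fourier_integral_measurable) auto
  have gm: "(\<lambda>x. gaussian ((1 / real (Suc n)) * x)) \<in> borel_measurable lebesgue" for n
    using gaussian_scale_integrable[of "1 / real (Suc n)"] by auto
  let ?h = "\<lambda>n \<xi>. ennreal ((cmod (fourier_integral f \<xi>))\<^sup>2 * cmod (gaussian ((1 / real (Suc n)) * \<xi>)))"
  have lim: "(\<lambda>n. ?h n \<xi>) \<longlonglongrightarrow> ennreal ((cmod (fourier_integral f \<xi>))\<^sup>2)" for \<xi>
  proof -
    have 0: "(\<lambda>n. 1 / real (Suc n)) \<longlonglongrightarrow> 0"
      using LIMSEQ_inverse_real_of_nat by (simp add: inverse_eq_divide)
    have "(\<lambda>n. (cmod (fourier_integral f \<xi>))\<^sup>2 * exp (- ((1 / real (Suc n)) * \<xi>)\<^sup>2 / 2)) \<longlonglongrightarrow>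
        (cmod (fourier_integral f \<xi>))\<^sup>2 * exp (- (0 * \<xi>)\<^sup>2 / 2)"
      by (intro tendsto_intros 0) auto
    then show ?thesis by (intro tendsto_ennrealI) (simp add: gaussian_def)
  qed
  have "energy (fourier_integral f) = (\<integral>\<^sup>+ \<xi>. liminf (\<lambda>n. ?h n \<xi>) \<partial>lebesgue)"
    unfolding energy_def by (intro nn_integral_cong lim_imp_Liminf[symmetric] lim) simp
  also have "\<dots> \<le> liminf (\<lambda>n. \<integral>\<^sup>+ \<xi>. ?h n \<xi> \<partial>lebesgue)"
    using gm by (intro nn_integral_liminf) measurable
  also have "\<dots> \<le> liminf (\<lambda>n::nat. ennreal (2 * pi) * energy f)"
    by (intro Liminf_mono always_eventually allI energy_fourier_smoothed_le f) simp
  also have "\<dots> = ennreal (2 * pi) * energy f"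
    by (simp add: Liminf_const)
  finally show ?thesis .
qed

section \<open>Injectivity of the Fourier integral on \<open>L\<^sup>1\<close>\<close>

text \<open>
  The positive and the negative part of \<open>k\<close> have the same mass, by the hypothesis at \<open>\<theta> = 0\<close>. After
  normalisation they are densities of two probability measures with equal characteristic functions,
  which agree by Levy's uniqueness theorem.
\<close>

lemma integrable_fourier_injective_real:
  fixes k :: "real \<Rightarrow> real"
  assumes [measurable]: "k \<in> borel_measurable borel" and k: "integrable lborel k"
    and zero: "\<And>\<theta>. (LINT x|lborel. exp (\<i> * complex_of_real (\<theta> * x)) * complex_of_real (k x)) = 0"
  shows "AE x in lborel. k x = 0"
proof -
  define c where "c = (LINT x|lborel. max 0 (k x))"
  have ip: "integrable lborel (\<lambda>x. max 0 (k x))" and im: "integrable lborel (\<lambda>x. max 0 (- k x))"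
    using k by (auto intro: integrable_max)
  have kdec: "k x = max 0 (k x) - max 0 (- k x)" for x by auto
  have "(LINT x|lborel. complex_of_real (k x)) = 0" using zero[of 0] by simp
  then have "(LINT x|lborel. k x) = 0" by simp
  then have c': "c = (LINT x|lborel. max 0 (- k x))"
    unfolding c_def using Bochner_Integration.integral_diff[OF ip im] by (simp flip: kdec)
  have "c \<ge> 0" unfolding c_def by (intro Bochner_Integration.integral_nonneg) auto
  show ?thesis
  proof (cases "c = 0")
    case True
    have "AE x in lborel. max 0 (k x) = 0"
      using True integral_nonneg_eq_0_iff_AE[OF ip] by (simp add: c_def)
    moreover have "AE x in lborel. max 0 (- k x) = 0"
      using True c' integral_nonneg_eq_0_iff_AE[OF im] by simp
    ultimately show ?thesis
      by eventually_elim (metis kdec diff_self)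
  next
    case False
    with \<open>c \<ge> 0\<close> have c: "c > 0" by simp
    \<comment> \<open>\<open>M 1\<close> and \<open>M (-1)\<close> are the normalised positive and negative part.\<close>
    define M where "M = (\<lambda>s. density lborel (\<lambda>x. ennreal (max 0 (s * k x) / c)))"
    have ints: "integrable lborel (\<lambda>x. max 0 (s * k x) / c)" for s
      using k by (intro integrable_divide integrable_max integrable_mult_right) auto
    have real_dist: "real_distribution (M s)" if s: "s = 1 \<or> s = -1" for s
    proof -
      have "(LINT x|lborel. max 0 (s * k x) / c) = 1"
        using s c c' by (auto simp: c_def)
      then have "emeasure (M s) (space (M s)) = 1"
        unfolding M_def using c ints[of s] by (simp add: emeasure_density nn_integral_eq_integral)
      then interpret prob_space "M s" by (rule prob_spaceI)
      show "real_distribution (M s)"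
        by standard (auto simp: M_def)
    qed
    have ch: "char (M s) \<theta> = (LINT x|lborel. exp (\<i> * complex_of_real (\<theta> * x)) * complex_of_real (max 0 (s * k x))) / c" for s \<theta>
    proof -
      have "char (M s) \<theta> = (LINT x|lborel. (max 0 (s * k x) / c) *\<^sub>R exp (\<i> * complex_of_real (\<theta> * x)))"
        unfolding char_def M_def using c by (subst integral_density) auto
      also have "\<dots> = (LINT x|lborel. (exp (\<i> * complex_of_real (\<theta> * x)) * complex_of_real (max 0 (s * k x))) / c)"
        by (intro Bochner_Integration.integral_cong) (auto simp: scaleR_conv_of_real)
      finally show ?thesis by simp
    qed
    have ie: "integrable lborel (\<lambda>x. exp (\<i> * complex_of_real (\<theta> * x)) * complex_of_real (max 0 (s * k x)))" for \<theta> s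
    proof (rule Bochner_Integration.integrable_bound)
      show "integrable lborel (\<lambda>x. max 0 (s * k x))"
        using k by (intro integrable_max integrable_mult_right) auto
    qed (auto simp: norm_mult)
    have "char (M 1) \<theta> = char (M (-1)) \<theta>" for \<theta>
    proof -
      have "(LINT x|lborel. exp (\<i> * complex_of_real (\<theta> * x)) * complex_of_real (max 0 (1 * k x)))
         - (LINT x|lborel. exp (\<i> * complex_of_real (\<theta> * x)) * complex_of_real (max 0 ((-1) * k x)))
         = (LINT x|lborel. exp (\<i> * complex_of_real (\<theta> * x)) * complex_of_real (k x))"
      proof -
        have e: "exp (\<i> * complex_of_real (\<theta> * x)) * complex_of_real (k x)
          = exp (\<i> * complex_of_real (\<theta> * x)) * complex_of_real (max 0 (1 * k x))
           - exp (\<i> * complex_of_real (\<theta> * x)) * complex_of_real (max 0 ((-1) * k x))" for x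
          by (subst kdec) (simp add: algebra_simps)
        show ?thesis unfolding e by (rule Bochner_Integration.integral_diff[OF ie ie, symmetric])
      qed
      then show ?thesis using zero[of \<theta>] by (simp add: ch)
    qed
    then have "M 1 = M (-1)"
      using real_dist by (intro Levy_uniqueness) (auto simp: fun_eq_iff)
    then have "AE x in lborel. ennreal (max 0 (1 * k x) / c) = ennreal (max 0 ((-1) * k x) / c)"
      unfolding M_def
      by (subst (asm) sigma_finite_measure.density_unique_iff[OF sigma_finite_lborel]) auto
    then show ?thesis
    proof eventually_elim
      case (elim x)
      then have "max 0 (k x) / c = max 0 (- k x) / c" using c by (simp add: ennreal_inj)
      then show ?case using c by (auto simp: max_def split: if_splits)
    qed
  qed
qed

lemma borel_representative:
  assumes "k \<in> borel_measurable (lebesgue :: real measure)"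
  obtains k' :: "real \<Rightarrow> real" where "k' \<in> borel_measurable borel" "AE x in lborel. k x = k' x"
proof -
  have "\<exists>k'\<in>borel_measurable lborel. AE x in lborel. k x = k' x"
    by (rule completion_ex_borel_measurable_real[OF assms])
  then show thesis using that by auto
qed

lemma fourier_integral_injective_real:
  fixes k :: "real \<Rightarrow> real"
  assumes k: "integrable lebesgue k"
    and zero: "\<And>\<xi>. fourier_integral (\<lambda>x. complex_of_real (k x)) \<xi> = 0"
  shows "AE x in lebesgue. k x = 0"
proof -
  have [measurable]: "k \<in> borel_measurable lebesgue" using k by auto
  obtain k' :: "real \<Rightarrow> real" where k'[measurable]: "k' \<in> borel_measurable borel" and AE: "AE x in lborel. k x = k' x"
    using borel_representative[of k] by auto
  have AE': "AE x in lebesgue. k x = k' x" using AE by (simp add: AE_completion_iff)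
  have [measurable]: "k' \<in> borel_measurable lebesgue" by (rule measurable_completion) simp
  have "integrable lebesgue k'"
    using k AE' by (subst integrable_cong_AE[of k' _ k]) auto
  then have "integrable lborel k'" by (simp add: integrable_completion)
  moreover have "(LINT x|lborel. exp (\<i> * complex_of_real (\<theta> * x)) * complex_of_real (k' x)) = 0" for \<theta>
  proof -
    have m: "(\<lambda>x. exp (- \<i> * complex_of_real (x * (- \<theta>)))) \<in> borel_measurable lebesgue"
      by measurable
    have "fourier_integral (\<lambda>x. complex_of_real (k x)) (- \<theta>) = fourier_integral (\<lambda>x. complex_of_real (k' x)) (- \<theta>)"
      unfolding fourier_integral_def
      by (rule integral_cong_AE) (use AE' m in \<open>auto intro!: borel_measurable_times\<close>)
    also have "\<dots> = (LINT x|lborel. exp (\<i> * complex_of_real (\<theta> * x)) * complex_of_real (k' x))"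
      by (subst fourier_integral_lborel) (auto simp: mult_ac)
    finally show ?thesis using zero by simp
  qed
  ultimately have "AE x in lborel. k' x = 0"
    by (intro integrable_fourier_injective_real) auto
  then have "AE x in lebesgue. k' x = 0" by (simp add: AE_completion_iff)
  with AE' show ?thesis by eventually_elim simp
qed

text \<open>
  The transforms of the real and of the imaginary part are combinations of those of \<open>k\<close> and of its
  conjugate, so the real case applies to each.
\<close>

lemma fourier_integral_injective:
  assumes k: "integrable lebesgue k" and zero: "\<And>\<xi>. fourier_integral k \<xi> = 0"
  shows "AE x in lebesgue. k x = 0"
proof -
  have kc: "integrable lebesgue (\<lambda>x. cnj (k x))" using k by simp
  have "fourier_integral (\<lambda>x. complex_of_real (Re (k x))) \<xi> = 0" for \<xi>
  proof -
    have "(\<lambda>x. complex_of_real (Re (k x))) = (\<lambda>x. (1/2) * (k x + cnj (k x)))"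
      by (simp add: complex_add_cnj)
    then show ?thesis
      by (simp only: fourier_integral_cmult fourier_integral_add[OF k kc] fourier_integral_cnj zero) simp
  qed
  then have "AE x in lebesgue. Re (k x) = 0"
    using k by (intro fourier_integral_injective_real) auto
  moreover have "fourier_integral (\<lambda>x. complex_of_real (Im (k x))) \<xi> = 0" for \<xi>
  proof -
    have "(\<lambda>x. complex_of_real (Im (k x))) = (\<lambda>x. (- \<i> / 2) * (k x - cnj (k x)))"
      by (simp add: complex_diff_cnj field_simps)
    then show ?thesis
      by (simp only: fourier_integral_cmult fourier_integral_diff[OF k kc] fourier_integral_cnj zero) simp
  qed
  then have "AE x in lebesgue. Im (k x) = 0"
    using k by (intro fourier_integral_injective_real) auto
  ultimately show ?thesis by eventually_elim (simp add: complex_eq_iff)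
qed

section \<open>The Fourier transform on \<open>L\<^sup>2\<close>\<close>

text \<open>
  The truncations by which \<open>is_fourier\<close> defines the transform of a square-integrable function.
\<close>

abbreviation truncate :: "real \<Rightarrow> (real \<Rightarrow> complex) \<Rightarrow> real \<Rightarrow> complex" where
  "truncate R f \<equiv> (\<lambda>x. indicator {-R..R} x * f x)"

lemma indicator_L2: "(indicator {-R..R} :: real \<Rightarrow> complex) \<in> L2"
proof (rule bounded_integrable_L2[where B = 1])
  show "integrable lebesgue (indicator {-R..R} :: real \<Rightarrow> complex)"
    using integrable_of_real[OF integrable_real_indicator[of "{-R..R}" lebesgue], where 'a=complex]
    by (simp add: of_real_indicator emeasure_lborel_Icc_eq)
qed (auto simp: indicator_def)

lemma truncate_L2: "f \<in> L2 \<Longrightarrow> truncate R f \<in> L2"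
  by (rule L2_mult_bounded[where B = 1]) (auto simp: indicator_def)

lemma truncate_integrable: "f \<in> L2 \<Longrightarrow> integrable lebesgue (truncate R f)"
  by (rule L2_mult_integrable[OF indicator_L2])

lemma truncate_tendsto:
  assumes "f \<in> L2"
  shows "((\<lambda>R. energy (\<lambda>x. truncate R f x - f x)) \<longlongrightarrow> 0) at_top"
proof -
  have [measurable]: "f \<in> borel_measurable lebesgue" using assms by (rule L2_measurable)
  have "((\<lambda>R. LINT x|lebesgue. (cmod (truncate R f x - f x))\<^sup>2) \<longlongrightarrow> (LINT x|(lebesgue::real measure). 0)) at_top"
  proof (rule integral_dominated_convergence_at_top)
    show "integrable lebesgue (\<lambda>x. (cmod (f x))\<^sup>2)" using assms by (simp add: L2_def)
    show "AE x in lebesgue. ((\<lambda>R. (cmod (truncate R f x - f x))\<^sup>2) \<longlongrightarrow> 0) at_top"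
    proof (rule AE_I2)
      fix x :: real
      have "\<forall>\<^sub>F R in at_top. (cmod (truncate R f x - f x))\<^sup>2 = 0"
        using eventually_ge_at_top[of "\<bar>x\<bar>"] by eventually_elim (auto simp: indicator_def)
      then show "((\<lambda>R. (cmod (truncate R f x - f x))\<^sup>2) \<longlongrightarrow> 0) at_top"
        by (rule tendsto_eventually)
    qed
    show "\<forall>\<^sub>F R in at_top. AE x in lebesgue. norm ((cmod (truncate R f x - f x))\<^sup>2) \<le> (cmod (f x))\<^sup>2"
      by (auto simp: indicator_def)
  qed auto
  then have "((\<lambda>R. ennreal (LINT x|lebesgue. (cmod (truncate R f x - f x))\<^sup>2)) \<longlongrightarrow> ennreal 0) at_top"
    by (intro tendsto_ennrealI) simp
  moreover have "energy (\<lambda>x. truncate R f x - f x) = ennreal (LINT x|lebesgue. (cmod (truncate R f x - f x))\<^sup>2)" for R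
    unfolding energy_def using L2_diff[OF truncate_L2[OF assms] assms, of R]
    by (intro nn_integral_eq_integral) (auto simp: L2_def)
  ultimately show ?thesis by simp
qed

lemma fourier_truncate_L2:
  assumes "f \<in> L2"
  shows "fourier_integral (truncate R f) \<in> L2"
proof -
  have "energy (fourier_integral (truncate R f)) \<le> ennreal (2 * pi) * energy (truncate R f)"
    by (rule energy_fourier_le[OF truncate_integrable[OF assms]])
  also have "\<dots> < \<infinity>" using truncate_L2[OF assms] by (auto simp: L2_iff ennreal_mult_less_top)
  finally show ?thesis using fourier_integral_measurable[of "truncate R f"] truncate_L2[OF assms, of R]
    by (auto simp: L2_iff)
qed

text \<open>
  The transforms of the truncations form a Cauchy family in \<open>L\<^sup>2\<close>: for radii beyond \<open>R\<close> the
  truncations differ only where \<open>f\<close> and its truncation to \<open>[-R, R]\<close> do.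
\<close>

lemma energy_fourier_truncate_diff_le:
  assumes f: "f \<in> L2" and R: "R \<le> R1" "R \<le> R2"
  shows "energy (\<lambda>\<xi>. fourier_integral (truncate R1 f) \<xi> - fourier_integral (truncate R2 f) \<xi>)
      \<le> ennreal (2 * pi) * energy (\<lambda>x. truncate R f x - f x)"
proof -
  have "energy (\<lambda>\<xi>. fourier_integral (truncate R1 f) \<xi> - fourier_integral (truncate R2 f) \<xi>)
      = energy (fourier_integral (\<lambda>x. truncate R1 f x - truncate R2 f x))"
    using fourier_integral_diff[OF truncate_integrable[OF f] truncate_integrable[OF f]] by presburger
  also have "\<dots> \<le> ennreal (2 * pi) * energy (\<lambda>x. truncate R1 f x - truncate R2 f x)"
    by (intro energy_fourier_le Bochner_Integration.integrable_diff truncate_integrable f)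
  also have "\<dots> \<le> ennreal (2 * pi) * energy (\<lambda>x. truncate R f x - f x)"
    unfolding energy_def using R
    by (intro mult_left_mono nn_integral_mono ennreal_leI power_mono) (auto simp: indicator_def)
  finally show ?thesis .
qed

lemma is_fourier_iff:
  "is_fourier f g \<longleftrightarrow> g \<in> L2 \<and> ((\<lambda>R. energy (\<lambda>\<xi>. fourier_integral (truncate R f) \<xi> - g \<xi>)) \<longlongrightarrow> 0) at_top"
  by (simp add: is_fourier_def energy_def)

text \<open>
  Completeness of \<open>L\<^sup>2\<close> for this particular Cauchy family. Multiplying by a Gaussian turns \<open>L\<^sup>2\<close> Cauchy
  into \<open>L\<^sup>1\<close> Cauchy, hence a subsequence converges almost everywhere; Fatou's lemma then shows that
  the pointwise limit is also the limit in \<open>L\<^sup>2\<close>.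
\<close>

lemma is_fourier_exists:
  assumes f: "f \<in> L2"
  shows "\<exists>g. is_fourier f g"
proof -
  define u where "u = (\<lambda>n::nat. fourier_integral (truncate (real n) f))"
  have uL2: "u n \<in> L2" for n unfolding u_def by (rule fourier_truncate_L2[OF f])
  have [measurable]: "u n \<in> borel_measurable lebesgue" for n using uL2 by (rule L2_measurable)
  have G: "energy gaussian < \<infinity>" using gaussian_L2 by (simp add: L2_iff)
  define E where "E = (\<lambda>R. energy (\<lambda>x. truncate R f x - f x))"
  have E: "(E \<longlongrightarrow> 0) at_top" unfolding E_def by (rule truncate_tendsto[OF f])
  have EC: "((\<lambda>R. ennreal (2 * pi) * E R) \<longlongrightarrow> ennreal (2 * pi) * 0) at_top"
    using E by (intro ennreal_tendsto_cmult) auto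
  obtain r where r: "strict_mono r" and rC: "AE x in lebesgue. Cauchy (\<lambda>i. u (r i) x * gaussian x)"
  proof (rule cauchy_L1_AE_cauchy_subseq[of lebesgue "\<lambda>n x. u n x * gaussian x"])
    show "integrable lebesgue (\<lambda>x. u n x * gaussian x)" for n
      by (rule L2_mult_integrable[OF uL2 gaussian_L2])
    fix e :: real assume e: "e > 0"
    have "((\<lambda>R. (ennreal (2 * pi) * E R) * energy gaussian) \<longlongrightarrow> (ennreal (2 * pi) * 0) * energy gaussian) at_top"
      using G by (intro ennreal_tendsto_mult_const EC) auto
    then have "((\<lambda>R. (ennreal (2 * pi) * E R) * energy gaussian) \<longlongrightarrow> 0) at_top" by simp
    then have "\<forall>\<^sub>F R in at_top. (ennreal (2 * pi) * E R) * energy gaussian < ennreal (e\<^sup>2)"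
      using e by (intro order_tendstoD(2)) auto
    then obtain R0 where R0: "\<And>R. R \<ge> R0 \<Longrightarrow> (ennreal (2 * pi) * E R) * energy gaussian < ennreal (e\<^sup>2)"
      by (auto simp: eventually_at_top_linorder)
    obtain N :: nat where N: "real N \<ge> R0" using real_arch_simple by blast
    show "\<exists>N. \<forall>i\<ge>N. \<forall>j\<ge>N. (LINT x|lebesgue. norm (u i x * gaussian x - u j x * gaussian x)) < e"
    proof (intro exI allI impI)
      fix i j assume ij: "N \<le> i" "N \<le> j"
      have "ennreal ((LINT x|lebesgue. cmod ((u i x - u j x) * gaussian x))\<^sup>2)
         \<le> energy (\<lambda>x. u i x - u j x) * energy gaussian"
        by (intro L2_Cauchy_Schwarz L2_diff uL2 gaussian_L2)
      also have "\<dots> \<le> (ennreal (2 * pi) * E N) * energy gaussian"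
        unfolding u_def E_def using ij by (intro mult_right_mono energy_fourier_truncate_diff_le f) auto
      also have "\<dots> < ennreal (e\<^sup>2)" using R0[OF N] .
      finally have "(LINT x|lebesgue. cmod ((u i x - u j x) * gaussian x))\<^sup>2 < e\<^sup>2"
        by (simp add: ennreal_less_iff)
      then have "(LINT x|lebesgue. cmod ((u i x - u j x) * gaussian x)) < e"
        using e by (intro power_less_imp_less_base[of _ 2 e]) auto
      then show "(LINT x|lebesgue. norm (u i x * gaussian x - u j x * gaussian x)) < e"
        by (simp add: left_diff_distrib)
    qed
  qed auto
  define g where "g = (\<lambda>x. lim (\<lambda>i. u (r i) x))"
  have g[measurable]: "g \<in> borel_measurable lebesgue" unfolding g_def by measurable
  have conv: "AE x in lebesgue. (\<lambda>i. u (r i) x) \<longlonglongrightarrow> g x"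
    using rC
  proof eventually_elim
    case (elim x)
    then obtain l where "(\<lambda>i. u (r i) x * gaussian x) \<longlonglongrightarrow> l" using Cauchy_convergent convergent_def by blast
    then have "(\<lambda>i. u (r i) x * gaussian x * inverse (gaussian x)) \<longlonglongrightarrow> l * inverse (gaussian x)"
      by (intro tendsto_intros)
    moreover have "gaussian x \<noteq> 0" by (simp add: gaussian_def)
    ultimately have "convergent (\<lambda>i. u (r i) x)" by (auto simp: convergent_def mult.assoc)
    then show ?case by (simp add: g_def convergent_LIMSEQ_iff)
  qed
  \<comment> \<open>Fatou's lemma along the subsequence turns the Cauchy estimate into a rate of convergence.\<close>
  have bound: "energy (\<lambda>\<xi>. fourier_integral (truncate R f) \<xi> - g \<xi>) \<le> ennreal (2 * pi) * E R" for R
  proof -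
    have [measurable]: "fourier_integral (truncate R f) \<in> borel_measurable lebesgue"
      using fourier_truncate_L2[OF f] by (rule L2_measurable)
    have "energy (\<lambda>\<xi>. fourier_integral (truncate R f) \<xi> - g \<xi>)
      = (\<integral>\<^sup>+ \<xi>. liminf (\<lambda>i. ennreal ((cmod (fourier_integral (truncate R f) \<xi> - u (r i) \<xi>))\<^sup>2)) \<partial>lebesgue)"
      unfolding energy_def
    proof (rule nn_integral_cong_AE, use conv in eventually_elim)
      case (elim x)
      then have "(\<lambda>i. ennreal ((cmod (fourier_integral (truncate R f) x - u (r i) x))\<^sup>2)) \<longlonglongrightarrow>
         ennreal ((cmod (fourier_integral (truncate R f) x - g x))\<^sup>2)"
        by (intro tendsto_intros tendsto_ennrealI)
      then show ?case by (intro lim_imp_Liminf[symmetric]) auto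
    qed
    also have "\<dots> \<le> liminf (\<lambda>i. \<integral>\<^sup>+ \<xi>. ennreal ((cmod (fourier_integral (truncate R f) \<xi> - u (r i) \<xi>))\<^sup>2) \<partial>lebesgue)"
      by (intro nn_integral_liminf) measurable
    also have "\<dots> \<le> liminf (\<lambda>i::nat. ennreal (2 * pi) * E R)"
    proof (rule Liminf_mono)
      have "\<forall>\<^sub>F i in sequentially. real i \<ge> R"
        using filterlim_real_sequentially by (auto simp: filterlim_at_top)
      then show "\<forall>\<^sub>F i in sequentially. (\<integral>\<^sup>+ \<xi>. ennreal ((cmod (fourier_integral (truncate R f) \<xi> - u (r i) \<xi>))\<^sup>2) \<partial>lebesgue)
          \<le> ennreal (2 * pi) * E R"
      proof eventually_elim
        case (elim i)
        have "real i \<le> real (r i)" using seq_suble[OF r, of i] by simp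
        with elim show ?case
          using energy_fourier_truncate_diff_le[OF f, of R R "real (r i)"]
          by (simp add: energy_def u_def E_def)
      qed
    qed
    finally show ?thesis by (simp add: Liminf_const)
  qed
  have lim: "((\<lambda>R. energy (\<lambda>\<xi>. fourier_integral (truncate R f) \<xi> - g \<xi>)) \<longlongrightarrow> 0) at_top"
    by (rule tendsto_sandwich[where f = "\<lambda>_. 0" and h = "\<lambda>R. ennreal (2 * pi) * E R"])
      (use bound EC in auto)
  \<comment> \<open>The radius \<open>1\<close> is arbitrary: any truncation has a transform at finite distance from \<open>g\<close>.\<close>
  have "g \<in> L2"
  proof -
    have [measurable]: "fourier_integral (truncate 1 f) \<in> borel_measurable lebesgue"
      using fourier_truncate_L2[OF f] by (rule L2_measurable)
    have "E 1 < \<infinity>" unfolding E_def using L2_diff[OF truncate_L2[OF f, of 1] f] by (simp add: L2_iff)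
    have "energy (\<lambda>\<xi>. g \<xi> - 0) \<le> 2 * energy (\<lambda>\<xi>. g \<xi> - fourier_integral (truncate 1 f) \<xi>)
        + 2 * energy (\<lambda>\<xi>. fourier_integral (truncate 1 f) \<xi> - 0)"
      by (rule energy_diff_le) auto
    also have "\<dots> \<le> 2 * (ennreal (2 * pi) * E 1) + 2 * energy (fourier_integral (truncate 1 f))"
      using bound[of 1] by (intro add_mono mult_left_mono) (auto simp: energy_minus[of g])
    also have "\<dots> < \<infinity>"
      using \<open>E 1 < \<infinity>\<close> fourier_truncate_L2[OF f, of 1] by (auto simp: L2_iff ennreal_mult_less_top)
    finally show ?thesis by (simp add: L2_iff)
  qed
  with lim show ?thesis by (auto simp: is_fourier_iff)
qed

lemma is_fourier_fourier: "f \<in> L2 \<Longrightarrow> is_fourier f (fourier f)"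
  unfolding fourier_def using is_fourier_exists by (rule someI_ex)

lemma is_fourier_cong_AE:
  assumes "is_fourier f g" "AE \<xi> in lebesgue. g \<xi> = g' \<xi>" "g' \<in> borel_measurable lebesgue"
  shows "is_fourier f g'"
proof -
  have "energy g' = energy g" using assms by (intro energy_cong_AE) auto
  moreover have "energy (\<lambda>\<xi>. fourier_integral (truncate R f) \<xi> - g' \<xi>) = energy (\<lambda>\<xi>. fourier_integral (truncate R f) \<xi> - g \<xi>)" for R
    using assms by (intro energy_cong_AE) auto
  ultimately show ?thesis using assms by (auto simp: is_fourier_iff L2_iff)
qed

lemma is_fourier_unique:
  assumes f: "f \<in> L2" and g: "is_fourier f g" and g': "is_fourier f g'"
  shows "AE \<xi> in lebesgue. g \<xi> = g' \<xi>"
proof -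
  have [measurable]: "g \<in> borel_measurable lebesgue" "g' \<in> borel_measurable lebesgue"
    using g g' by (auto simp: is_fourier_iff L2_iff)
  have [measurable]: "fourier_integral (truncate R f) \<in> borel_measurable lebesgue" for R
    using fourier_truncate_L2[OF f] by (rule L2_measurable)
  let ?e = "\<lambda>R. 2 * energy (\<lambda>\<xi>. fourier_integral (truncate R f) \<xi> - g \<xi>) + 2 * energy (\<lambda>\<xi>. fourier_integral (truncate R f) \<xi> - g' \<xi>)"
  have "(?e \<longlongrightarrow> 2 * 0 + 2 * 0) at_top"
    using g g' unfolding is_fourier_iff by (intro tendsto_add ennreal_tendsto_cmult) auto
  moreover have "energy (\<lambda>\<xi>. g \<xi> - g' \<xi>) \<le> ?e R" for R
    using energy_diff_le[of g g' "fourier_integral (truncate R f)"] by (simp add: energy_minus[of g])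
  ultimately have "energy (\<lambda>\<xi>. g \<xi> - g' \<xi>) \<le> 0"
    by (intro tendsto_lowerbound[of ?e _ at_top]) auto
  then show ?thesis by (simp add: energy_eq_0_iff)
qed

text \<open>
  The multiplication formula passes to the limit of the truncations on both sides.
\<close>

lemma is_fourier_integral_mult:
  assumes f: "f \<in> L2" and g: "is_fourier f g" and \<phi>: "integrable lebesgue \<phi>" "\<phi> \<in> L2" "fourier_integral \<phi> \<in> L2"
  shows "(LINT \<xi>|lebesgue. g \<xi> * \<phi> \<xi>) = (LINT x|lebesgue. f x * fourier_integral \<phi> x)"
proof (rule LIMSEQ_unique)
  have "(\<lambda>n. energy (\<lambda>\<xi>. fourier_integral (truncate (real n) f) \<xi> - g \<xi>)) \<longlonglongrightarrow> 0"
    using g filterlim_compose[OF _ filterlim_real_sequentially] by (auto simp: is_fourier_iff)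
  then show "(\<lambda>n. LINT \<xi>|lebesgue. fourier_integral (truncate (real n) f) \<xi> * \<phi> \<xi>) \<longlonglongrightarrow> (LINT \<xi>|lebesgue. g \<xi> * \<phi> \<xi>)"
    using g \<phi> fourier_truncate_L2[OF f] by (intro energy_tendsto_integral_tendsto) (auto simp: is_fourier_iff)
  have "(\<lambda>n. energy (\<lambda>x. truncate (real n) f x - f x)) \<longlonglongrightarrow> 0"
    using filterlim_compose[OF truncate_tendsto[OF f] filterlim_real_sequentially] .
  then show "(\<lambda>n. LINT \<xi>|lebesgue. fourier_integral (truncate (real n) f) \<xi> * \<phi> \<xi>) \<longlonglongrightarrow> (LINT x|lebesgue. f x * fourier_integral \<phi> x)"
    unfolding fourier_integral_mult[OF truncate_integrable[OF f] \<phi>(1)]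
    using \<phi> truncate_L2[OF f] f by (intro energy_tendsto_integral_tendsto) auto
qed

text \<open>
  Conjugation replaces the usual reflection: the inverse transform of \<open>g\<close> is the conjugate of the
  transform of the conjugate of \<open>g\<close>, up to the factor \<open>2\<pi>\<close>. Let \<open>h\<close> be the transform of the conjugate
  of \<open>g\<close>. Two applications of the multiplication formula to a modulated Gaussian show that the
  difference of \<open>h\<close> and the claimed transform, times a Gaussian, has vanishing Fourier integral.
\<close>

lemma fourier_inversion:
  assumes f: "f \<in> L2" and g: "is_fourier f g"
  shows "is_fourier (\<lambda>\<xi>. cnj (g \<xi>)) (\<lambda>x. 2 * complex_of_real pi * cnj (f x))"
proof -
  have gL2: "g \<in> L2" using g by (simp add: is_fourier_iff)
  obtain h where h: "is_fourier (\<lambda>\<xi>. cnj (g \<xi>)) h"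
    using is_fourier_exists[OF L2_cnj[OF gL2]] by blast
  then have hL2: "h \<in> L2" by (simp add: is_fourier_iff)
  let ?f = "\<lambda>x. 2 * complex_of_real pi * cnj (f x)"
  have f'L2: "?f \<in> L2" by (intro L2_cmult L2_cnj f)
  let ?k = "\<lambda>x. (h x - ?f x) * gaussian x"
  have "integrable lebesgue ?k" by (intro L2_mult_integrable L2_diff hL2 f'L2 gaussian_L2)
  moreover have "fourier_integral ?k \<xi> = 0" for \<xi>
  proof -
    define \<theta> where "\<theta> = - \<xi>"
    define \<phi> where "\<phi> = (\<lambda>x. exp (\<i> * complex_of_real (\<theta> * x)) * gaussian x)"
    define \<psi> where "\<psi> = (\<lambda>x. complex_of_real (sqrt (2 * pi)) * gaussian (x - \<theta>))"
    have F\<phi>: "fourier_integral \<phi> = \<psi>"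
      unfolding \<phi>_def \<psi>_def by (simp only: fun_eq_iff fourier_integral_modulate fourier_gaussian) simp
    have F\<psi>: "fourier_integral \<psi> x = 2 * complex_of_real pi * cnj (\<phi> x)" for x
    proof -
      have "complex_of_real (sqrt (2 * pi)) * complex_of_real (sqrt (2 * pi)) = 2 * complex_of_real pi"
        by (simp flip: of_real_mult) simp
      moreover have "cnj (\<phi> x) = exp (- \<i> * complex_of_real (\<theta> * x)) * gaussian x"
        unfolding \<phi>_def by (simp add: exp_cnj gaussian_def)
      moreover have "fourier_integral \<psi> x = (complex_of_real (sqrt (2 * pi)) * complex_of_real (sqrt (2 * pi)))
          * (exp (- \<i> * complex_of_real (\<theta> * x)) * gaussian x)"
        unfolding \<psi>_def fourier_integral_cmult fourier_integral_translate[OF gaussian_measurable]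
          fourier_gaussian by (simp only: mult_ac)
      ultimately show ?thesis by (simp only:)
    qed
    have \<phi>: "integrable lebesgue \<phi>" "\<phi> \<in> L2"
      unfolding \<phi>_def by (rule gaussian_modulate_integrable gaussian_modulate_L2)+
    have \<psi>: "integrable lebesgue \<psi>" "\<psi> \<in> L2"
      unfolding \<psi>_def by (intro integrable_mult_right gaussian_translate_integrable L2_cmult gaussian_translate_L2)+
    have F\<psi>L2: "fourier_integral \<psi> \<in> L2"
      unfolding F\<psi>[abs_def] by (intro L2_cmult L2_cnj \<phi>)
    have "(LINT x|lebesgue. h x * \<phi> x) = (LINT \<xi>|lebesgue. cnj (g \<xi>) * \<psi> \<xi>)"
      using is_fourier_integral_mult[OF L2_cnj[OF gL2] h \<phi>] \<psi> by (simp add: F\<phi>)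
    also have "\<dots> = cnj (LINT \<xi>|lebesgue. g \<xi> * \<psi> \<xi>)"
      by (simp add: \<psi>_def gaussian_def flip: Bochner_Integration.integral_cnj)
    also have "\<dots> = cnj (LINT x|lebesgue. f x * fourier_integral \<psi> x)"
      using is_fourier_integral_mult[OF f g \<psi> F\<psi>L2] by simp
    also have "\<dots> = (LINT x|lebesgue. ?f x * \<phi> x)"
      by (simp add: F\<psi> mult_ac flip: Bochner_Integration.integral_cnj)
    finally have "(LINT x|lebesgue. h x * \<phi> x) - (LINT x|lebesgue. ?f x * \<phi> x) = 0" by simp
    then have "(LINT x|lebesgue. h x * \<phi> x - ?f x * \<phi> x) = 0"
      using Bochner_Integration.integral_diff[OF L2_mult_integrable[OF hL2 \<phi>(2)] L2_mult_integrable[OF f'L2 \<phi>(2)]]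
      by simp
    moreover have "fourier_integral ?k \<xi> = (LINT x|lebesgue. h x * \<phi> x - ?f x * \<phi> x)"
      unfolding fourier_integral_def \<phi>_def \<theta>_def
      by (intro Bochner_Integration.integral_cong) (auto simp: algebra_simps)
    ultimately show ?thesis by simp
  qed
  ultimately have "AE x in lebesgue. ?k x = 0" by (rule fourier_integral_injective)
  then have "AE x in lebesgue. h x = ?f x"
    by eventually_elim (auto simp: gaussian_def)
  with h show ?thesis using f'L2 by (rule is_fourier_cong_AE[OF _ _ L2_measurable])
qed

lemma is_fourier_cmult:
  assumes f: "f \<in> L2" and "is_fourier f g"
  shows "is_fourier (\<lambda>x. c * f x) (\<lambda>\<xi>. c * g \<xi>)"
proof -
  have [measurable]: "fourier_integral (truncate R f) \<in> borel_measurable lebesgue" "g \<in> borel_measurable lebesgue" for R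
    using fourier_truncate_L2[OF f] assms by (auto simp: is_fourier_iff L2_iff)
  have "energy (\<lambda>\<xi>. fourier_integral (truncate R (\<lambda>x. c * f x)) \<xi> - c * g \<xi>)
      = ennreal ((cmod c)\<^sup>2) * energy (\<lambda>\<xi>. fourier_integral (truncate R f) \<xi> - g \<xi>)" for R
  proof -
    have "truncate R (\<lambda>x. c * f x) = (\<lambda>x. c * truncate R f x)" by (simp add: mult_ac)
    then have "energy (\<lambda>\<xi>. fourier_integral (truncate R (\<lambda>x. c * f x)) \<xi> - c * g \<xi>)
        = energy (\<lambda>\<xi>. c * (fourier_integral (truncate R f) \<xi> - g \<xi>))"
      by (simp only: fourier_integral_cmult right_diff_distrib)
    also have "\<dots> = ennreal ((cmod c)\<^sup>2) * energy (\<lambda>\<xi>. fourier_integral (truncate R f) \<xi> - g \<xi>)"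
      by (rule energy_cmult) measurable
    finally show ?thesis .
  qed
  moreover have "((\<lambda>R. ennreal ((cmod c)\<^sup>2) * energy (\<lambda>\<xi>. fourier_integral (truncate R f) \<xi> - g \<xi>)) \<longlongrightarrow> ennreal ((cmod c)\<^sup>2) * 0) at_top"
    using assms by (intro ennreal_tendsto_cmult) (auto simp: is_fourier_iff)
  ultimately show ?thesis using assms by (auto simp: is_fourier_iff intro: L2_cmult)
qed

lemma fourier_surjective:
  assumes g: "g \<in> L2"
  shows "\<exists>f\<in>L2. AE \<xi> in lebesgue. fourier f \<xi> = g \<xi>"
proof -
  obtain h where h: "is_fourier (\<lambda>\<xi>. cnj (g \<xi>)) h"
    using is_fourier_exists[OF L2_cnj[OF g]] by blast
  then have hL2: "h \<in> L2" by (simp add: is_fourier_iff)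
  define f where "f = (\<lambda>x. (1 / (2 * complex_of_real pi)) * cnj (h x))"
  have f: "f \<in> L2" unfolding f_def by (intro L2_cmult L2_cnj hL2)
  have "is_fourier (\<lambda>x. cnj (h x)) (\<lambda>x. 2 * complex_of_real pi * g x)"
    using fourier_inversion[OF L2_cnj[OF g] h] by simp
  then have "is_fourier f (\<lambda>\<xi>. (1 / (2 * complex_of_real pi)) * (2 * complex_of_real pi * g \<xi>))"
    unfolding f_def by (intro is_fourier_cmult L2_cnj hL2)
  then have "is_fourier f g" by simp
  then show ?thesis using is_fourier_unique[OF f is_fourier_fourier[OF f]] f by blast
qed

section \<open>The evolution on the Fourier side\<close>

text \<open>
  The inverse Fourier integral of \<open>g(\<xi>) exp (z \<bar>\<xi>\<bar>\<^sup>a)\<close>. A complex \<open>z\<close> in place of a time makes the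
  dependence holomorphic for compactly supported \<open>g\<close>; the path \<open>t \<mapsto> i t - t\<^sup>\<gamma>\<close>, which for \<open>\<gamma> < 1\<close> is not
  differentiable at \<open>0\<close>, enters separately.
\<close>

definition evolution :: "real \<Rightarrow> complex \<Rightarrow> (real \<Rightarrow> complex) \<Rightarrow> real \<Rightarrow> complex" where
  "evolution a z g x = 1 / (2 * complex_of_real pi) *
     (LINT \<xi>|lebesgue. g \<xi> * exp (\<i> * complex_of_real (x * \<xi>)) * exp (z * complex_of_real (\<bar>\<xi>\<bar> powr a)))"

definition landau_time :: "real \<Rightarrow> real \<Rightarrow> complex" where
  "landau_time \<gamma> t = \<i> * complex_of_real t - complex_of_real (t powr \<gamma>)"

lemma landau_schroedinger_eq_evolution:
  "landau_schroedinger a \<gamma> t f x = evolution a (landau_time \<gamma> t) (fourier f) x"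
proof -
  have "fourier f \<xi> * exp (\<i> * complex_of_real (x * \<xi>)) * exp (\<i> * complex_of_real (t * \<bar>\<xi>\<bar> powr a))
      * complex_of_real (exp (- (t powr \<gamma>) * \<bar>\<xi>\<bar> powr a))
      = fourier f \<xi> * exp (\<i> * complex_of_real (x * \<xi>))
        * exp ((\<i> * complex_of_real t - complex_of_real (t powr \<gamma>)) * complex_of_real (\<bar>\<xi>\<bar> powr a))" for \<xi>
  proof -
    have "exp ((\<i> * complex_of_real t - complex_of_real (t powr \<gamma>)) * complex_of_real (\<bar>\<xi>\<bar> powr a))
        = exp (\<i> * complex_of_real (t * \<bar>\<xi>\<bar> powr a) + complex_of_real (- (t powr \<gamma>) * \<bar>\<xi>\<bar> powr a))"
      by (rule arg_cong[where f = exp]) (simp add: algebra_simps)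
    then show ?thesis by (simp only: exp_add exp_of_real mult.assoc)
  qed
  then show ?thesis
    unfolding landau_schroedinger_def evolution_def landau_time_def by (simp only:)
qed

lemma landau_time_0 [simp]: "landau_time \<gamma> 0 = 0"
  by (simp add: landau_time_def)

lemma Re_landau_time [simp]: "Re (landau_time \<gamma> t) = - (t powr \<gamma>)"
  by (simp add: landau_time_def)

lemma evolution_integrand_measurable [measurable]:
  assumes [measurable]: "g \<in> borel_measurable lebesgue"
  shows "(\<lambda>\<xi>. g \<xi> * exp (\<i> * complex_of_real (x * \<xi>)) * exp (z * complex_of_real (\<bar>\<xi>\<bar> powr a))) \<in> borel_measurable lebesgue"
  by measurable

lemma norm_evolution_integrand:
  "cmod (g * exp (\<i> * complex_of_real (x * \<xi>)) * exp (z * complex_of_real (\<bar>\<xi>\<bar> powr a)))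
     = cmod g * exp (Re z * \<bar>\<xi>\<bar> powr a)"
  by (simp add: norm_mult)

lemma norm_evolution_integrand_le:
  assumes "Re z \<le> 0"
  shows "cmod (g * exp (\<i> * complex_of_real (x * \<xi>)) * exp (z * complex_of_real (\<bar>\<xi>\<bar> powr a))) \<le> cmod g"
proof -
  have "exp (Re z * \<bar>\<xi>\<bar> powr a) \<le> 1" using assms by (simp add: mult_nonpos_nonneg)
  then show ?thesis unfolding norm_evolution_integrand by (simp add: mult_left_le)
qed

lemma evolution_integrand_integrable:
  assumes g: "integrable lebesgue g" and z: "Re z \<le> 0"
  shows "integrable lebesgue (\<lambda>\<xi>. g \<xi> * exp (\<i> * complex_of_real (x * \<xi>)) * exp (z * complex_of_real (\<bar>\<xi>\<bar> powr a)))"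
proof (rule Bochner_Integration.integrable_bound[OF g])
  show "(\<lambda>\<xi>. g \<xi> * exp (\<i> * complex_of_real (x * \<xi>)) * exp (z * complex_of_real (\<bar>\<xi>\<bar> powr a))) \<in> borel_measurable lebesgue"
    using g by (intro evolution_integrand_measurable) auto
qed (use z norm_evolution_integrand_le in blast)

lemma evolution_cong_AE:
  assumes "AE \<xi> in lebesgue. g \<xi> = g' \<xi>" "g \<in> borel_measurable lebesgue" "g' \<in> borel_measurable lebesgue"
  shows "evolution a z g x = evolution a z g' x"
  unfolding evolution_def using assms
  by (intro arg_cong2[where f = "(*)"] refl integral_cong_AE) (auto intro: evolution_integrand_measurable)

text \<open>
  This moves an estimate near \<open>0\<close> to any other point while staying on the Fourier side.
\<close>

lemma evolution_modulate:
  "evolution a z (\<lambda>\<xi>. exp (\<i> * complex_of_real (y * \<xi>)) * g \<xi>) x = evolution a z g (y + x)"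
proof -
  have "exp (\<i> * complex_of_real ((y + x) * \<xi>)) = exp (\<i> * complex_of_real (y * \<xi>)) * exp (\<i> * complex_of_real (x * \<xi>))" for \<xi>
    by (simp add: algebra_simps exp_add)
  then show ?thesis unfolding evolution_def by (simp only: mult_ac)
qed

lemma evolution_sum:
  assumes "finite I" "\<And>i. i \<in> I \<Longrightarrow> integrable lebesgue (g i)" "Re z \<le> 0"
  shows "(\<Sum>i\<in>I. evolution a z (g i) x) = evolution a z (\<lambda>\<xi>. \<Sum>i\<in>I. g i \<xi>) x"
proof -
  have "(LINT \<xi>|lebesgue. (\<Sum>i\<in>I. g i \<xi> * exp (\<i> * complex_of_real (x * \<xi>)) * exp (z * complex_of_real (\<bar>\<xi>\<bar> powr a))))
      = (\<Sum>i\<in>I. (LINT \<xi>|lebesgue. g i \<xi> * exp (\<i> * complex_of_real (x * \<xi>)) * exp (z * complex_of_real (\<bar>\<xi>\<bar> powr a))))"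
    using assms by (intro Bochner_Integration.integral_sum evolution_integrand_integrable)
  then show ?thesis
    unfolding evolution_def sum_distrib_right sum_distrib_left[symmetric] by simp
qed

lemma evolution_continuous:
  assumes g: "integrable lebesgue g" and z: "Re z \<le> 0"
  shows "continuous_on UNIV (evolution a z g)"
proof (rule continuous_on_sequentiallyI)
  fix u :: "nat \<Rightarrow> real" and x assume u: "u \<longlonglongrightarrow> x"
  have [measurable]: "g \<in> borel_measurable lebesgue" using g by auto
  show "(\<lambda>n. evolution a z g (u n)) \<longlonglongrightarrow> evolution a z g x"
    unfolding evolution_def
  proof (intro tendsto_mult tendsto_const integral_dominated_convergence)
    show "integrable lebesgue (\<lambda>\<xi>. cmod (g \<xi>))" using g by simp
    show "AE \<xi> in lebesgue. (\<lambda>n. g \<xi> * exp (\<i> * complex_of_real (u n * \<xi>)) * exp (z * complex_of_real (\<bar>\<xi>\<bar> powr a)))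
       \<longlonglongrightarrow> g \<xi> * exp (\<i> * complex_of_real (x * \<xi>)) * exp (z * complex_of_real (\<bar>\<xi>\<bar> powr a))"
      by (intro AE_I2 tendsto_intros u)
  qed (use z norm_evolution_integrand_le in \<open>auto intro!: AE_I2 evolution_integrand_measurable\<close>)
qed

text \<open>
  Differentiation under the integral, with a quadratic Taylor remainder that is uniform in \<open>\<xi>\<close>
  because \<open>\<bar>\<xi>\<bar>\<^sup>a\<close> is bounded on the support of \<open>g\<close>.
\<close>

lemma evolution_has_field_derivative:
  assumes g: "integrable lebesgue g" and W: "\<And>\<xi>. g \<xi> \<noteq> 0 \<Longrightarrow> \<bar>\<xi>\<bar> powr a \<le> W"
  shows "((\<lambda>z. evolution a z g x) has_field_derivative
           evolution a z (\<lambda>\<xi>. complex_of_real (\<bar>\<xi>\<bar> powr a) * g \<xi>) x) (at z)"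
proof -
  have [measurable]: "g \<in> borel_measurable lebesgue" using g by auto
  define e where "e = (\<lambda>z \<xi>. g \<xi> * exp (\<i> * complex_of_real (x * \<xi>)) * exp (z * complex_of_real (\<bar>\<xi>\<bar> powr a)))"
  define e' where "e' = (\<lambda>\<xi>. complex_of_real (\<bar>\<xi>\<bar> powr a) * g \<xi> * exp (\<i> * complex_of_real (x * \<xi>)) * exp (z * complex_of_real (\<bar>\<xi>\<bar> powr a)))"
  have em[measurable]: "e z \<in> borel_measurable lebesgue" for z unfolding e_def by measurable
  have e'm[measurable]: "e' \<in> borel_measurable lebesgue" unfolding e'_def by measurable
  have Re_le: "Re z * \<bar>\<xi>\<bar> powr a \<le> cmod z * \<bar>W\<bar>" if "g \<xi> \<noteq> 0" for z \<xi>
  proof -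
    have "Re z * \<bar>\<xi>\<bar> powr a \<le> cmod z * \<bar>\<xi>\<bar> powr a" by (intro mult_right_mono complex_Re_le_cmod) auto
    also have "\<dots> \<le> cmod z * \<bar>W\<bar>" using W[OF that] by (intro mult_left_mono) auto
    finally show ?thesis .
  qed
  have e_le: "cmod (e z \<xi>) \<le> exp (cmod z * \<bar>W\<bar>) * cmod (g \<xi>)" for z \<xi>
  proof (cases "g \<xi> = 0")
    case False
    then have "exp (Re z * \<bar>\<xi>\<bar> powr a) \<le> exp (cmod z * \<bar>W\<bar>)" using Re_le by simp
    then have "cmod (g \<xi>) * exp (Re z * \<bar>\<xi>\<bar> powr a) \<le> cmod (g \<xi>) * exp (cmod z * \<bar>W\<bar>)"
      by (rule mult_left_mono) simp
    then show ?thesis unfolding e_def norm_evolution_integrand by (simp only: mult.commute)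
  qed (simp add: e_def)
  have ei: "integrable lebesgue (e z)" for z
    by (rule Bochner_Integration.integrable_bound[where f = "\<lambda>\<xi>. exp (cmod z * \<bar>W\<bar>) * cmod (g \<xi>)"])
      (use g e_le in auto)
  have e'_eq: "e' \<xi> = complex_of_real (\<bar>\<xi>\<bar> powr a) * e z \<xi>" for \<xi> by (simp add: e'_def e_def mult_ac)
  have e'_le: "cmod (e' \<xi>) \<le> \<bar>W\<bar> * cmod (e z \<xi>)" for \<xi>
  proof (cases "g \<xi> = 0")
    case False
    then have "\<bar>\<xi>\<bar> powr a \<le> \<bar>W\<bar>" using W[OF False] by simp
    then show ?thesis by (simp add: e'_eq norm_mult mult_right_mono)
  qed (simp add: e'_eq e_def)
  have e'i: "integrable lebesgue e'"
    by (rule Bochner_Integration.integrable_bound[where f = "\<lambda>\<xi>. \<bar>W\<bar> * cmod (e z \<xi>)"])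
      (use ei e'_le in auto)
  define C where "C = exp \<bar>W\<bar> * \<bar>W\<bar>\<^sup>2 * (LINT \<xi>|lebesgue. cmod (e z \<xi>))"
  have bound: "cmod ((integral\<^sup>L lebesgue (e (z + h)) - integral\<^sup>L lebesgue (e z)) / h - integral\<^sup>L lebesgue e') \<le> C * cmod h"
    if h: "h \<noteq> 0" "cmod h \<le> 1" for h
  proof -
    have "(integral\<^sup>L lebesgue (e (z + h)) - integral\<^sup>L lebesgue (e z)) / h - integral\<^sup>L lebesgue e'
        = (LINT \<xi>|lebesgue. (e (z + h) \<xi> - e z \<xi>) / h - e' \<xi>)"
      using ei e'i by simp
    also have "cmod \<dots> \<le> (LINT \<xi>|lebesgue. (exp \<bar>W\<bar> * \<bar>W\<bar>\<^sup>2 * cmod h) * cmod (e z \<xi>))"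
    proof (rule order_trans[OF integral_norm_bound integral_mono])
      show "integrable lebesgue (\<lambda>\<xi>. cmod ((e (z + h) \<xi> - e z \<xi>) / h - e' \<xi>))" using ei e'i by simp
      show "integrable lebesgue (\<lambda>\<xi>. (exp \<bar>W\<bar> * \<bar>W\<bar>\<^sup>2 * cmod h) * cmod (e z \<xi>))" using ei by simp
      fix \<xi> :: real
      show "cmod ((e (z + h) \<xi> - e z \<xi>) / h - e' \<xi>) \<le> (exp \<bar>W\<bar> * \<bar>W\<bar>\<^sup>2 * cmod h) * cmod (e z \<xi>)"
      proof (cases "g \<xi> = 0")
        case False
        define w where "w = \<bar>\<xi>\<bar> powr a"
        have w: "0 \<le> w" "w \<le> \<bar>W\<bar>" using W[OF False] by (auto simp: w_def)
        have hw: "cmod (h * complex_of_real w) = cmod h * w" using w by (simp add: norm_mult)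
        have "\<bar>Re (h * complex_of_real w)\<bar> \<le> 1 * \<bar>W\<bar>"
          using order_trans[OF abs_Re_le_cmod[of "h * complex_of_real w"]] mult_mono[OF h(2) w(2)] w hw by simp
        then have ex: "exp \<bar>Re (h * complex_of_real w)\<bar> \<le> exp \<bar>W\<bar>" by simp
        have "cmod (exp (h * complex_of_real w) - 1 - h * complex_of_real w)
           \<le> exp \<bar>Re (h * complex_of_real w)\<bar> * (cmod h * w)\<^sup>2"
          using Taylor_exp[of "h * complex_of_real w" 1] hw by (simp add: algebra_simps power2_eq_square)
        also have "\<dots> \<le> exp \<bar>W\<bar> * (cmod h * \<bar>W\<bar>)\<^sup>2"
          using ex w by (intro mult_mono power_mono mult_left_mono) auto
        finally have T: "cmod (exp (h * complex_of_real w) - 1 - h * complex_of_real w) \<le> exp \<bar>W\<bar> * (cmod h * \<bar>W\<bar>)\<^sup>2" .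
        have "(e (z + h) \<xi> - e z \<xi>) / h - e' \<xi> = e z \<xi> * (exp (h * complex_of_real w) - 1 - h * complex_of_real w) / h"
          using h by (simp add: e_def e'_def w_def distrib_right exp_add divide_simps) (simp add: algebra_simps)
        also have "cmod \<dots> \<le> cmod (e z \<xi>) * (exp \<bar>W\<bar> * (cmod h * \<bar>W\<bar>)\<^sup>2) / cmod h"
          unfolding norm_divide norm_mult using T by (intro divide_right_mono mult_left_mono) auto
        also have "\<dots> = (exp \<bar>W\<bar> * \<bar>W\<bar>\<^sup>2 * cmod h) * cmod (e z \<xi>)"
          using h by (simp add: power2_eq_square field_simps)
        finally show ?thesis .
      qed (simp add: e_def e'_def)
    qed
    also have "\<dots> = C * cmod h" by (simp add: C_def)
    finally show ?thesis .
  qed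
  have "((\<lambda>h. (integral\<^sup>L lebesgue (e (z + h)) - integral\<^sup>L lebesgue (e z)) / h) \<longlongrightarrow> integral\<^sup>L lebesgue e') (at 0)"
  proof (rule LIM_zero_cancel, rule Lim_null_comparison)
    show "\<forall>\<^sub>F h in at 0. norm ((integral\<^sup>L lebesgue (e (z + h)) - integral\<^sup>L lebesgue (e z)) / h - integral\<^sup>L lebesgue e') \<le> C * cmod h"
      unfolding eventually_at by (rule exI[of _ 1]) (use bound in auto)
    have "((\<lambda>h::complex. C * cmod h) \<longlongrightarrow> C * cmod 0) (at 0)" by (intro tendsto_intros)
    then show "((\<lambda>h::complex. C * cmod h) \<longlongrightarrow> 0) (at 0)" by simp
  qed
  then have "((\<lambda>z. integral\<^sup>L lebesgue (e z)) has_field_derivative integral\<^sup>L lebesgue e') (at z)"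
    by (simp add: DERIV_def)
  then have "((\<lambda>z. 1 / (2 * complex_of_real pi) * integral\<^sup>L lebesgue (e z)) has_field_derivative 1 / (2 * complex_of_real pi) * integral\<^sup>L lebesgue e') (at z)"
    by (rule DERIV_cmult)
  then show ?thesis by (simp add: evolution_def e_def e'_def)
qed

lemma landau_time_continuous: "\<gamma> > 0 \<Longrightarrow> continuous_on {0..} (landau_time \<gamma>)"
  unfolding landau_time_def[abs_def]
  by (intro continuous_intros continuous_on_powr') auto

lemma landau_time_has_vector_derivative:
  assumes "r > 0"
  shows "(landau_time \<gamma> has_vector_derivative \<i> - complex_of_real (\<gamma> * r powr (\<gamma> - 1))) (at r)"
proof -
  have "((\<lambda>r. r powr \<gamma>) has_real_derivative \<gamma> * r powr (\<gamma> - 1)) (at r)"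
    using assms by (rule has_real_derivative_powr)
  then have "((\<lambda>r. complex_of_real (r powr \<gamma>)) has_vector_derivative complex_of_real (\<gamma> * r powr (\<gamma> - 1))) (at r)"
    by (rule has_vector_derivative_of_real)
  moreover have "((\<lambda>r. \<i> * complex_of_real r) has_vector_derivative \<i> * complex_of_real 1) (at r)"
    by (intro has_vector_derivative_mult_right has_vector_derivative_of_real DERIV_ident)
  ultimately show ?thesis unfolding landau_time_def[abs_def]
    by (auto intro: has_vector_derivative_diff)
qed

lemma evolution_time_continuous:
  assumes g: "integrable lebesgue g" and W: "\<And>\<xi>. g \<xi> \<noteq> 0 \<Longrightarrow> \<bar>\<xi>\<bar> powr a \<le> W" and "\<gamma> > 0"
  shows "continuous_on {0..} (\<lambda>t. evolution a (landau_time \<gamma> t) g x)"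
proof -
  have "continuous_on UNIV (\<lambda>z. evolution a z g x)"
    using evolution_has_field_derivative[OF g W]
    by (intro continuous_at_imp_continuous_on ballI DERIV_isCont) blast
  then show ?thesis using landau_time_continuous[OF \<open>\<gamma> > 0\<close>]
    by (rule continuous_on_compose2) auto
qed

text \<open>
  The mean value inequality along the path \<open>i r - r\<^sup>\<gamma>\<close>, whose speed is at most \<open>1 + \<gamma> r\<^bsup>\<gamma>-1\<^esup>\<close>, the derivative
  of \<open>r + r\<^sup>\<gamma>\<close>. Comparing with that function rather than with a constant allows \<open>\<gamma> < 1\<close>, when the
  speed is unbounded near \<open>0\<close>.
\<close>

lemma evolution_difference_le:
  assumes g: "integrable lebesgue g" and W: "\<And>\<xi>. g \<xi> \<noteq> 0 \<Longrightarrow> \<bar>\<xi>\<bar> powr a \<le> W" and "\<gamma> > 0"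
    and t: "0 < t" "t < 1"
    and M: "\<And>r. 0 < r \<Longrightarrow> r < 1 \<Longrightarrow>
      cmod (evolution a (landau_time \<gamma> r) (\<lambda>\<xi>. complex_of_real (\<bar>\<xi>\<bar> powr a) * g \<xi>) x) \<le> M"
  shows "cmod (evolution a (landau_time \<gamma> t) g x - evolution a 0 g x) \<le> (t + t powr \<gamma>) * M"
proof -
  let ?\<psi> = "\<lambda>r. evolution a (landau_time \<gamma> r) (\<lambda>\<xi>. complex_of_real (\<bar>\<xi>\<bar> powr a) * g \<xi>) x"
  have "norm (evolution a (landau_time \<gamma> t) g x - evolution a (landau_time \<gamma> 0) g x)
      \<le> (t + t powr \<gamma>) * M - (0 + 0 powr \<gamma>) * M"
  proof (rule differentiable_bound_general[OF t(1)])
    show "continuous_on {0..t} (\<lambda>t. evolution a (landau_time \<gamma> t) g x)"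
      using evolution_time_continuous[OF g W \<open>\<gamma> > 0\<close>] by (rule continuous_on_subset) auto
    show "continuous_on {0..t} (\<lambda>t. (t + t powr \<gamma>) * M)"
      using \<open>\<gamma> > 0\<close> by (intro continuous_intros continuous_on_powr') auto
    fix r assume r: "0 < r" "r < t"
    show "((\<lambda>t. evolution a (landau_time \<gamma> t) g x) has_vector_derivative
        (\<i> - complex_of_real (\<gamma> * r powr (\<gamma> - 1))) * ?\<psi> r) (at r)"
      using field_vector_diff_chain_at[OF landau_time_has_vector_derivative[OF r(1), of \<gamma>]
          evolution_has_field_derivative[OF g W]] by (simp add: o_def)
    show "((\<lambda>t. (t + t powr \<gamma>) * M) has_vector_derivative (1 + \<gamma> * r powr (\<gamma> - 1)) * M) (at r)"
      unfolding has_real_derivative_iff_has_vector_derivative[symmetric]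
      using r by (auto intro!: derivative_eq_intros)
    have "cmod (\<i> - complex_of_real (\<gamma> * r powr (\<gamma> - 1))) \<le> 1 + \<gamma> * r powr (\<gamma> - 1)"
      using norm_triangle_ineq4[of \<i> "complex_of_real (\<gamma> * r powr (\<gamma> - 1))"] \<open>\<gamma> > 0\<close> by (simp add: norm_mult)
    then show "norm ((\<i> - complex_of_real (\<gamma> * r powr (\<gamma> - 1))) * ?\<psi> r) \<le> (1 + \<gamma> * r powr (\<gamma> - 1)) * M"
      unfolding norm_mult using M[of r] r t \<open>\<gamma> > 0\<close> by (intro mult_mono) auto
  qed
  then show ?thesis by simp
qed

text \<open>
  From \<open>exp v \<ge> (v / n)\<^sup>n\<close> with \<open>a n \<ge> 2\<close> the function decays at least like \<open>1 / (1 + \<xi>\<^sup>2)\<close>.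
\<close>

lemma exp_decay_integrable:
  assumes "a > 0" "c > 0"
  shows "integrable lebesgue (\<lambda>\<xi>. complex_of_real (exp (- c * \<bar>\<xi>\<bar> powr a)))"
proof -
  obtain n :: nat where n: "2 / a \<le> real n" "0 < n"
    by (metis gr0I less_eq_real_def of_nat_0 order_less_le_trans real_arch_simple zero_less_divide_iff assms(1) zero_less_numeral not_less)
  define C where "C = (real n / c) ^ n"
  have C: "C \<ge> 0" using assms by (simp add: C_def)
  have bound: "exp (- c * \<bar>\<xi>\<bar> powr a) \<le> (2 + 2 * C) * inverse (1 + \<xi>\<^sup>2)" for \<xi>
  proof (cases "\<bar>\<xi>\<bar> \<le> 1")
    case True
    then have "\<xi>\<^sup>2 \<le> 1" by (simp add: abs_square_le_1)
    moreover have "0 < 1 + \<xi>\<^sup>2" by (simp add: add_pos_nonneg)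
    ultimately have "1 \<le> 2 * inverse (1 + \<xi>\<^sup>2)" by (simp add: field_simps)
    also have "\<dots> \<le> (2 + 2 * C) * inverse (1 + \<xi>\<^sup>2)" using C by (intro mult_right_mono) auto
    finally show ?thesis using assms by (smt (verit) exp_le_one_iff mult_minus_left mult_nonneg_nonneg powr_ge_zero)
  next
    case False
    define u where "u = \<bar>\<xi>\<bar> powr a"
    have u: "u > 0" using False by (auto simp: u_def)
    have "\<xi>\<^sup>2 = \<bar>\<xi>\<bar> powr 2" using False by (simp add: powr_numeral)
    also have "\<dots> \<le> \<bar>\<xi>\<bar> powr (a * n)" using False n assms by (intro powr_mono) (auto simp: field_simps)
    also have "\<dots> = u ^ n" using u by (simp add: u_def powr_powr powr_realpow[symmetric])
    finally have xi: "\<xi>\<^sup>2 \<le> u ^ n" .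
    have "(c * u / n) ^ n \<le> exp (c * u / n) ^ n"
      using assms u by (intro power_mono) (auto intro: order_trans[OF _ exp_ge_add_one_self])
    also have "\<dots> = exp (c * u)" using n by (simp add: exp_of_nat_mult[symmetric])
    finally have "u ^ n \<le> C * exp (c * u)"
      using assms n by (simp add: C_def power_mult_distrib power_divide field_simps)
    then have "\<xi>\<^sup>2 * exp (- (c * u)) \<le> C" using xi by (simp add: exp_minus field_simps)
    moreover have "exp (- (c * u)) \<le> 1" using assms u by simp
    ultimately have "(1 + \<xi>\<^sup>2) * exp (- (c * u)) \<le> 2 + 2 * C"
      unfolding distrib_right using C by linarith
    moreover have "0 < 1 + \<xi>\<^sup>2" by (simp add: add_pos_nonneg)
    ultimately show ?thesis unfolding mult_minus_left u_def[symmetric] by (simp add: field_simps)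
  qed
  have "integrable lborel (\<lambda>x::real. inverse (1 + x\<^sup>2))"
    using integrable_inverse_1_plus_square by (simp add: set_integrable_def)
  then have "integrable lebesgue (\<lambda>x::real. inverse (1 + x\<^sup>2))" by (simp add: integrable_completion)
  then have "integrable lebesgue (\<lambda>x::real. (2 + 2 * C) * inverse (1 + x\<^sup>2))" by simp
  then have "integrable lebesgue (\<lambda>\<xi>. exp (- c * \<bar>\<xi>\<bar> powr a))"
    by (rule Bochner_Integration.integrable_bound) (use order_trans[OF bound abs_ge_self] in auto)
  then show ?thesis by (rule integrable_of_real)
qed

text \<open>
  Damping makes the integrand of a square-integrable \<open>g\<close> integrable, so dominated convergence applies.
\<close>

lemma evolution_truncate_tendsto:
  assumes "a > 0" "Re z < 0" "g \<in> L2"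
  shows "(\<lambda>n. evolution a z (truncate (2 ^ n) g) x) \<longlonglongrightarrow> evolution a z g x"
  unfolding evolution_def
proof (intro tendsto_mult tendsto_const integral_dominated_convergence)
  have [measurable]: "g \<in> borel_measurable lebesgue" using assms by (simp add: L2_measurable)
  let ?w = "\<lambda>\<xi>. complex_of_real (exp (- (- Re z) * \<bar>\<xi>\<bar> powr a))"
  have "?w \<in> L2"
    using assms by (intro bounded_integrable_L2[where B = 1] exp_decay_integrable) (auto simp: mult_nonpos_nonneg)
  then have "integrable lebesgue (\<lambda>\<xi>. norm (g \<xi> * ?w \<xi>))" using assms by (intro integrable_norm L2_mult_integrable)
  then show "integrable lebesgue (\<lambda>\<xi>. cmod (g \<xi>) * exp (Re z * \<bar>\<xi>\<bar> powr a))" by (simp add: norm_mult)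
  show "(\<lambda>\<xi>. g \<xi> * exp (\<i> * complex_of_real (x * \<xi>)) * exp (z * complex_of_real (\<bar>\<xi>\<bar> powr a))) \<in> borel_measurable lebesgue"
    by measurable
  show "(\<lambda>\<xi>. truncate (2 ^ n) g \<xi> * exp (\<i> * complex_of_real (x * \<xi>)) * exp (z * complex_of_real (\<bar>\<xi>\<bar> powr a))) \<in> borel_measurable lebesgue" for n
    by measurable
  show "AE \<xi> in lebesgue. cmod (truncate (2 ^ n) g \<xi> * exp (\<i> * complex_of_real (x * \<xi>)) * exp (z * complex_of_real (\<bar>\<xi>\<bar> powr a)))
      \<le> cmod (g \<xi>) * exp (Re z * \<bar>\<xi>\<bar> powr a)" for n
    unfolding norm_evolution_integrand by (intro AE_I2 mult_right_mono) (auto simp: indicator_def)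
  show "AE \<xi> in lebesgue. (\<lambda>n. truncate (2 ^ n) g \<xi> * exp (\<i> * complex_of_real (x * \<xi>)) * exp (z * complex_of_real (\<bar>\<xi>\<bar> powr a)))
      \<longlonglongrightarrow> g \<xi> * exp (\<i> * complex_of_real (x * \<xi>)) * exp (z * complex_of_real (\<bar>\<xi>\<bar> powr a))"
  proof (intro AE_I2 tendsto_mult tendsto_const)
    fix \<xi> :: real
    obtain N where N: "\<bar>\<xi>\<bar> \<le> 2 ^ N" using real_arch_pow[of 2 "\<bar>\<xi>\<bar>"] by (auto intro: less_imp_le)
    have "\<forall>\<^sub>F n in sequentially. truncate (2 ^ n) g \<xi> = g \<xi>"
      using eventually_ge_at_top[of N]
    proof eventually_elim
      case (elim n)
      then have "(2::real) ^ N \<le> 2 ^ n" by simp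
      with N have "\<bar>\<xi>\<bar> \<le> 2 ^ n" by linarith
      then show ?case by (auto simp: indicator_def abs_le_iff)
    qed
    then show "(\<lambda>n. truncate (2 ^ n) g \<xi>) \<longlonglongrightarrow> g \<xi>" by (rule tendsto_eventually)
  qed
qed

lemma evolution_0_truncate:
  "evolution a 0 (truncate R g) x
     = 1 / (2 * complex_of_real pi) * cnj (fourier_integral (truncate R (\<lambda>\<xi>. cnj (g \<xi>))) x)"
proof -
  have "cnj (exp (- \<i> * complex_of_real (\<xi> * x)) * (indicator {- R..R} \<xi> * cnj (g \<xi>)))
      = indicator {- R..R} \<xi> * g \<xi> * exp (\<i> * complex_of_real (x * \<xi>)) * exp (0 * complex_of_real (\<bar>\<xi>\<bar> powr a))" for \<xi>
    by (simp add: exp_cnj indicator_def mult_ac)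
  then show ?thesis
    unfolding evolution_def fourier_integral_def by (simp only: flip: Bochner_Integration.integral_cnj)
qed

lemma evolution_0_truncate_L2:
  assumes "g \<in> L2"
  shows "evolution a 0 (truncate R g) \<in> L2"
  unfolding evolution_0_truncate[abs_def] by (intro L2_cmult L2_cnj fourier_truncate_L2 assms)

text \<open>
  The inversion theorem, read off at time \<open>0\<close>: the inverse Fourier integrals over \<open>[-R, R]\<close> converge
  to \<open>f\<close> in \<open>L\<^sup>2\<close>.
\<close>

lemma evolution_0_truncate_tendsto:
  assumes f: "f \<in> L2"
  shows "((\<lambda>R. energy (\<lambda>x. evolution a 0 (truncate R (fourier f)) x - f x)) \<longlongrightarrow> 0) at_top"
proof -
  let ?g = "fourier f" and ?F = "\<lambda>R. fourier_integral (truncate R (\<lambda>\<xi>. cnj (fourier f \<xi>)))"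
    and ?c = "1 / (2 * complex_of_real pi)"
  have inv: "is_fourier (\<lambda>\<xi>. cnj (?g \<xi>)) (\<lambda>x. 2 * complex_of_real pi * cnj (f x))"
    by (rule fourier_inversion[OF f is_fourier_fourier[OF f]])
  have gL2: "?g \<in> L2" using is_fourier_fourier[OF f] by (simp add: is_fourier_iff)
  have [measurable]: "?F R \<in> borel_measurable lebesgue" "f \<in> borel_measurable lebesgue"
     "(\<lambda>x. cnj (f x)) \<in> borel_measurable lebesgue" for R
    using fourier_truncate_L2[OF L2_cnj[OF gL2]] f L2_cnj[OF f] by (auto intro: L2_measurable)
  have "energy (\<lambda>x. evolution a 0 (truncate R ?g) x - f x)
      = ennreal ((cmod ?c)\<^sup>2) * energy (\<lambda>x. ?F R x - 2 * complex_of_real pi * cnj (f x))" for R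
  proof -
    have "evolution a 0 (truncate R ?g) x - f x = cnj (?c * (?F R x - 2 * complex_of_real pi * cnj (f x)))" for x
      unfolding evolution_0_truncate by (simp add: right_diff_distrib)
    then have "energy (\<lambda>x. evolution a 0 (truncate R ?g) x - f x)
        = energy (\<lambda>x. ?c * (?F R x - 2 * complex_of_real pi * cnj (f x)))"
      by (simp only: energy_cnj)
    also have "\<dots> = ennreal ((cmod ?c)\<^sup>2) * energy (\<lambda>x. ?F R x - 2 * complex_of_real pi * cnj (f x))"
      by (rule energy_cmult) measurable
    finally show ?thesis .
  qed
  moreover have "((\<lambda>R. ennreal ((cmod ?c)\<^sup>2) * energy (\<lambda>x. ?F R x - 2 * complex_of_real pi * cnj (f x)))
      \<longlongrightarrow> ennreal ((cmod ?c)\<^sup>2) * 0) at_top"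
    using inv by (intro ennreal_tendsto_cmult) (auto simp: is_fourier_iff)
  ultimately show ?thesis by simp
qed

section \<open>The maximal estimate in \<open>L\<^sup>1\<close> of a unit ball\<close>

text \<open>
  For each \<open>D > 0\<close> one has \<open>u \<le> D + D\<^bsup>1-p\<^esup> u\<^sup>p\<close> pointwise. With \<open>D\<close> at least the \<open>L\<^sup>p\<close> norm, the second term
  integrates to at most \<open>D\<close>, and the first one to \<open>2 D\<close> since the ball has length \<open>2\<close>.
\<close>

lemma set_nn_integral_le_Lp_norm:
  assumes p: "p \<ge> 1" and A: "A \<ge> 0" and u[measurable]: "u \<in> borel_measurable lebesgue"
    and le: "Lp_norm p (ball 0 1) u \<le> ennreal A"
  shows "(\<integral>\<^sup>+x\<in>ball 0 1. u x \<partial>lebesgue) \<le> ennreal (3 * A)"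
proof -
  have upm[measurable]: "(\<lambda>x. ennreal_powr (u x) p) \<in> borel_measurable lebesgue"
    unfolding ennreal_powr_def by measurable
  define I where "I = (\<integral>\<^sup>+x\<in>ball 0 1. ennreal_powr (u x) p \<partial>lebesgue)"
  have "ennreal_powr I (1 / p) \<le> ennreal A" using le by (simp add: Lp_norm_def I_def)
  then have "I \<noteq> \<infinity>" by (auto simp: ennreal_powr_def top_unique)
  then obtain i where i: "I = ennreal i" "i \<ge> 0" by (cases I) auto
  with \<open>ennreal_powr I (1 / p) \<le> ennreal A\<close> A have iA: "i powr (1 / p) \<le> A"
    by (simp add: ennreal_powr_def)
  have main: "(\<integral>\<^sup>+x\<in>ball 0 1. u x \<partial>lebesgue) \<le> ennreal (3 * D)" if D: "D > 0" "A \<le> D" for D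
  proof -
    have "i = (i powr (1 / p)) powr p" using i p by (simp add: powr_powr)
    also have "\<dots> \<le> D powr p" using iA D p by (intro powr_mono2) auto
    finally have iD: "i \<le> D powr p" .
    have pt: "u x \<le> ennreal D + ennreal (D powr (1 - p)) * ennreal_powr (u x) p" for x
    proof (cases "u x")
      case top
      then show ?thesis using D by (simp add: ennreal_powr_def ennreal_mult_top)
    next
      case (real v)
      have "v \<le> D + D powr (1 - p) * v powr p"
      proof (cases "v \<le> D")
        case False
        then have "v = v powr (1 - p) * v powr p" using D by (simp flip: powr_add)
        also have "\<dots> \<le> D powr (1 - p) * v powr p"
          using False D p by (intro mult_right_mono powr_mono2') auto
        finally show ?thesis using D by simp
      qed (use D in \<open>simp add: add_increasing2\<close>)
      then show ?thesis using real D
        by (simp add: ennreal_powr_def ennreal_leI flip: ennreal_mult ennreal_plus)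
    qed
    have "(\<integral>\<^sup>+x\<in>ball 0 1. u x \<partial>lebesgue)
        \<le> (\<integral>\<^sup>+x. ennreal D * indicator (ball 0 1) x
            + ennreal (D powr (1 - p)) * (ennreal_powr (u x) p * indicator (ball 0 1) x) \<partial>lebesgue)"
      using pt by (intro nn_integral_mono) (auto simp: indicator_def)
    also have "\<dots> = ennreal D * emeasure lebesgue (ball (0::real) 1) + ennreal (D powr (1 - p)) * I"
    proof -
      have [measurable]: "ball (0::real) 1 \<in> sets lebesgue" by simp
      have "(\<integral>\<^sup>+x. ennreal D * indicator (ball (0::real) 1) x \<partial>lebesgue) = ennreal D * emeasure lebesgue (ball (0::real) 1)"
        by (rule nn_integral_cmult_indicator) measurable
      moreover have "(\<integral>\<^sup>+x. ennreal (D powr (1 - p)) * (ennreal_powr (u x) p * indicator (ball 0 1) x) \<partial>lebesgue)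
          = ennreal (D powr (1 - p)) * I"
        unfolding I_def by (rule nn_integral_cmult) measurable
      ultimately show ?thesis by (subst nn_integral_add) auto
    qed
    also have "emeasure lebesgue (ball (0::real) 1) = ennreal 2"
      by (simp add: ball_eq_greaterThanLessThan)
    also have "ennreal D * ennreal 2 + ennreal (D powr (1 - p)) * I
        = ennreal (D * 2 + D powr (1 - p) * i)"
      using D i by (simp add: ennreal_mult)
    also have "\<dots> \<le> ennreal (D * 2 + D powr (1 - p) * D powr p)"
      using iD D by (intro ennreal_leI add_left_mono mult_left_mono) auto
    also have "\<dots> = ennreal (3 * D)" using D by (simp flip: powr_add)
    finally show ?thesis .
  qed
  \<comment> \<open>The bound with \<open>D = A\<close> is not available when \<open>A = 0\<close>; approach \<open>A\<close> from above.\<close>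
  show ?thesis
  proof (rule ennreal_le_epsilon)
    fix e :: real assume "e > 0"
    then have "(\<integral>\<^sup>+x\<in>ball 0 1. u x \<partial>lebesgue) \<le> ennreal (3 * (A + e / 3))"
      using A by (intro main) auto
    also have "\<dots> = ennreal (3 * A) + ennreal e" using A \<open>e > 0\<close> by (simp flip: ennreal_plus)
    finally show "(\<integral>\<^sup>+x\<in>ball 0 1. u x \<partial>lebesgue) \<le> ennreal (3 * A) + ennreal e" .
  qed
qed

definition weighted_energy :: "real \<Rightarrow> (real \<Rightarrow> complex) \<Rightarrow> ennreal" where
  "weighted_energy s g = (\<integral>\<^sup>+ \<xi>. ennreal ((1 + \<bar>\<xi>\<bar>\<^sup>2) powr s * (cmod (g \<xi>))\<^sup>2) \<partial>lebesgue)"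

lemma weighted_energy_cong_AE:
  assumes "AE \<xi> in lebesgue. g \<xi> = g' \<xi>"
  shows "weighted_energy s g = weighted_energy s g'"
  unfolding weighted_energy_def using assms by (intro nn_integral_cong_AE) auto

text \<open>
  By surjectivity of the Fourier transform, the maximal estimate can be applied to any function
  prescribed on the Fourier side.
\<close>

lemma sobolev_representative:
  assumes g: "g \<in> L2" and B: "B \<ge> 0" "weighted_energy s g \<le> ennreal (B\<^sup>2)"
  obtains f where "f \<in> sobolev s" "AE \<xi> in lebesgue. fourier f \<xi> = g \<xi>" "sobolev_norm s f \<le> B"
proof -
  obtain f where f: "f \<in> L2" and fg: "AE \<xi> in lebesgue. fourier f \<xi> = g \<xi>"
    using fourier_surjective[OF g] by blast
  have [measurable]: "fourier f \<in> borel_measurable lebesgue"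
    using is_fourier_fourier[OF f] by (auto simp: is_fourier_iff intro: L2_measurable)
  let ?h = "\<lambda>\<xi>. (1 + \<bar>\<xi>\<bar>\<^sup>2) powr s * (cmod (fourier f \<xi>))\<^sup>2"
  have le: "(\<integral>\<^sup>+ \<xi>. ennreal (?h \<xi>) \<partial>lebesgue) \<le> ennreal (B\<^sup>2)"
    using B(2) weighted_energy_cong_AE[OF fg, of s] by (simp add: weighted_energy_def)
  have int: "integrable lebesgue ?h"
    unfolding integrable_iff_bounded
  proof
    show "(\<integral>\<^sup>+ \<xi>. ennreal (norm (?h \<xi>)) \<partial>lebesgue) < \<infinity>"
      using order_le_less_trans[OF le, of \<infinity>] by (simp add: abs_mult)
  qed measurable
  have "ennreal (integral\<^sup>L lebesgue ?h) \<le> ennreal (B\<^sup>2)"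
    using le nn_integral_eq_integral[OF int] by simp
  then have "integral\<^sup>L lebesgue ?h \<le> B\<^sup>2" by simp
  then have "(integral\<^sup>L lebesgue ?h) powr (1 / 2) \<le> (B\<^sup>2) powr (1 / 2)"
    by (intro powr_mono2) (auto intro!: Bochner_Integration.integral_nonneg)
  also have "\<dots> = B" using B(1) by (simp add: powr_half_sqrt)
  finally have "sobolev_norm s f \<le> B" by (simp add: sobolev_norm_def)
  moreover have "f \<in> sobolev s" using f int by (simp add: sobolev_def)
  ultimately show ?thesis using fg that by blast
qed

definition landau_maximal :: "real \<Rightarrow> real \<Rightarrow> (real \<Rightarrow> complex) \<Rightarrow> real \<Rightarrow> ennreal" where
  "landau_maximal a \<gamma> g x = (SUP t\<in>{0<..<1}. ennreal (cmod (evolution a (landau_time \<gamma> t) g x)))"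

text \<open>
  A supremum of uncountably many continuous functions is lower semicontinuous.
\<close>

lemma landau_maximal_measurable:
  assumes g: "integrable lebesgue g"
  shows "landau_maximal a \<gamma> g \<in> borel_measurable borel"
proof (rule borel_measurableI_greater)
  fix c :: ennreal
  have "open {x. c < ennreal (cmod (evolution a (landau_time \<gamma> t) g x))}" for t
  proof (rule open_Collect_less)
    show "continuous_on UNIV (\<lambda>x. ennreal (cmod (evolution a (landau_time \<gamma> t) g x)))"
      by (intro continuous_on_ennreal continuous_on_norm evolution_continuous g) simp
  qed simp
  then have "open (\<Union>t\<in>{0<..<1}. {x. c < ennreal (cmod (evolution a (landau_time \<gamma> t) g x))})"
    by (intro open_UN) auto
  also have "(\<Union>t\<in>{0<..<1}. {x. c < ennreal (cmod (evolution a (landau_time \<gamma> t) g x))}) = {x. c < landau_maximal a \<gamma> g x}"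
    unfolding landau_maximal_def less_SUP_iff by auto
  finally show "{x \<in> space borel. c < landau_maximal a \<gamma> g x} \<in> sets borel" by simp
qed

text \<open>
  The maximal estimate is assumed for Sobolev functions, in \<open>L\<^sup>p\<close> and around \<open>0\<close>. It passes to the Fourier
  side by surjectivity, and to a ball around \<open>y\<close> because the modulated \<open>g\<close> has the same weighted energy.
\<close>

lemma maximal_estimate_L1:
  assumes p: "p \<ge> 1" and C: "C \<ge> 0"
    and max: "\<And>f. f \<in> sobolev s \<Longrightarrow> Lp_norm p (ball 0 1)
          (\<lambda>x. SUP t \<in> {0<..<1}. ennreal (cmod (landau_schroedinger a \<gamma> t f x))) \<le> ennreal (C * sobolev_norm s f)"
    and g: "g \<in> L2" "integrable lebesgue g" and B: "B \<ge> 0" "weighted_energy s g \<le> ennreal (B\<^sup>2)"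
  shows "(\<integral>\<^sup>+x\<in>ball y 1. landau_maximal a \<gamma> g x \<partial>lebesgue) \<le> ennreal (3 * (C * B))"
proof -
  define gy where "gy = (\<lambda>\<xi>. exp (\<i> * complex_of_real (y * \<xi>)) * g \<xi>)"
  have gyL2: "gy \<in> L2" unfolding gy_def
    using g by (intro L2_mult_bounded[where B = 1]) auto
  have gyi: "integrable lebesgue gy"
    using integrable_character[OF g(2), of "- y"] by (simp add: gy_def mult_ac)
  have "weighted_energy s gy \<le> ennreal (B\<^sup>2)" using B by (simp add: weighted_energy_def gy_def norm_mult)
  then obtain f where f: "f \<in> sobolev s" "AE \<xi> in lebesgue. fourier f \<xi> = gy \<xi>" "sobolev_norm s f \<le> B"
    using sobolev_representative[OF gyL2 B(1)] by blast
  have fm: "fourier f \<in> borel_measurable lebesgue"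
    using f(1) is_fourier_fourier[of f] by (auto simp: is_fourier_iff sobolev_def intro: L2_measurable)
  have "(SUP t \<in> {0<..<1}. ennreal (cmod (landau_schroedinger a \<gamma> t f x))) = landau_maximal a \<gamma> gy x" for x
    unfolding landau_maximal_def landau_schroedinger_eq_evolution
    using evolution_cong_AE[OF f(2) fm L2_measurable[OF gyL2]] by simp
  moreover have "landau_maximal a \<gamma> gy x = landau_maximal a \<gamma> g (y + x)" for x
    unfolding landau_maximal_def gy_def evolution_modulate ..
  ultimately have "Lp_norm p (ball 0 1) (\<lambda>x. landau_maximal a \<gamma> g (y + x)) \<le> ennreal (C * sobolev_norm s f)"
    using max[OF f(1)] by simp
  also have "\<dots> \<le> ennreal (C * B)" using C f(3) by (intro ennreal_leI mult_left_mono)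
  finally have Lp: "Lp_norm p (ball 0 1) (\<lambda>x. landau_maximal a \<gamma> g (y + x)) \<le> ennreal (C * B)" .
  have [measurable]: "landau_maximal a \<gamma> g \<in> borel_measurable borel" by (rule landau_maximal_measurable[OF g(2)])
  have [measurable]: "landau_maximal a \<gamma> g \<in> borel_measurable lebesgue" by (rule measurable_completion) simp
  have "(\<integral>\<^sup>+x\<in>ball y 1. landau_maximal a \<gamma> g x \<partial>lebesgue)
     = ennreal \<bar>1\<bar> * (\<integral>\<^sup>+x. landau_maximal a \<gamma> g (y + 1 * x) * indicator (ball y 1) (y + 1 * x) \<partial>lebesgue)"
    by (intro nn_integral_real_affine_lebesgue borel_measurable_times_ennreal borel_measurable_indicator) auto
  also have "\<dots> = (\<integral>\<^sup>+x\<in>ball 0 1. landau_maximal a \<gamma> g (y + x) \<partial>lebesgue)"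
    by (auto intro!: nn_integral_cong simp: indicator_def dist_norm)
  also have "\<dots> \<le> ennreal (3 * (C * B))"
    using Lp C B(1) p by (intro set_nn_integral_le_Lp_norm) (auto intro: measurable_completion)
  finally show ?thesis .
qed

section \<open>Dyadic decomposition\<close>

text \<open>
  The shells contain their outer and not their inner boundary points, so that the first \<open>n + 1\<close> of them
  partition exactly \<open>[-2\<^sup>n, 2\<^sup>n]\<close>, the set of a truncation.
\<close>

definition dyadic_shell :: "nat \<Rightarrow> real set" where
  "dyadic_shell k = (if k = 0 then {-1..1} else {- (2 ^ k)..2 ^ k} - {- (2 ^ (k - 1))..2 ^ (k - 1)})"

lemma dyadic_shell_measurable [measurable]: "dyadic_shell k \<in> sets borel"
  by (simp add: dyadic_shell_def)

lemma sum_indicator_dyadic_shell: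
  "(\<Sum>k\<le>n. indicator (dyadic_shell k) \<xi>) = (indicator {- (2 ^ n)..2 ^ n} \<xi> :: complex)"
proof (induction n)
  case (Suc n)
  have "(2::real) ^ n \<le> 2 ^ Suc n" by simp
  then have "indicator {- (2 ^ n)..2 ^ n} \<xi> + indicator (dyadic_shell (Suc n)) \<xi>
      = (indicator {- (2 ^ Suc n)..2 ^ Suc n} \<xi> :: complex)"
    unfolding dyadic_shell_def by (auto simp: indicator_def)
  with Suc show ?case by (simp del: power_Suc)
qed (simp add: dyadic_shell_def)

lemma dyadic_shell_upper: "\<xi> \<in> dyadic_shell k \<Longrightarrow> \<bar>\<xi>\<bar> \<le> 2 powr k"
  by (auto simp: dyadic_shell_def powr_realpow abs_le_iff split: if_splits)

text \<open>
  For \<open>k = 0\<close> the left-hand side is below \<open>1\<close>, so that one formula serves all shells.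
\<close>

lemma dyadic_shell_lower:
  assumes "\<xi> \<in> dyadic_shell k"
  shows "2 powr (2 * (real k - 1)) \<le> 1 + \<bar>\<xi>\<bar>\<^sup>2"
proof (cases k)
  case 0
  have "2 powr (2 * (real k - 1)) \<le> (2::real) powr 0" using 0 by (intro powr_mono) auto
  also have "\<dots> \<le> 1 + \<bar>\<xi>\<bar>\<^sup>2" by simp
  finally show ?thesis .
next
  case (Suc n)
  have "2 ^ n \<le> \<bar>\<xi>\<bar>" using assms Suc by (auto simp: dyadic_shell_def abs_if)
  then have "(2 ^ n)\<^sup>2 \<le> \<bar>\<xi>\<bar>\<^sup>2" by (intro power_mono) auto
  moreover have "2 powr (2 * (real k - 1)) = ((2::real) ^ n)\<^sup>2"
    using Suc powr_realpow[of 2 "n * 2"] by (simp add: power_mult mult.commute)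
  ultimately show ?thesis by simp
qed

definition dyadic_piece :: "(real \<Rightarrow> complex) \<Rightarrow> nat \<Rightarrow> real \<Rightarrow> complex" where
  "dyadic_piece g k \<xi> = indicator (dyadic_shell k) \<xi> * g \<xi>"

lemma dyadic_shell_subset: "dyadic_shell k \<subseteq> {- (2 ^ k)..2 ^ k}"
  by (auto simp: dyadic_shell_def)

lemma dyadic_piece_L2: "g \<in> L2 \<Longrightarrow> dyadic_piece g k \<in> L2"
  unfolding dyadic_piece_def[abs_def]
  by (rule L2_mult_bounded[where B = 1]) (auto simp: indicator_def intro!: measurable_completion)

lemma dyadic_piece_integrable:
  assumes "g \<in> L2"
  shows "integrable lebesgue (dyadic_piece g k)"
proof -
  have "dyadic_piece g k = truncate (2 ^ k) (dyadic_piece g k)"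
    using dyadic_shell_subset[of k] by (auto simp: dyadic_piece_def indicator_def fun_eq_iff)
  then show ?thesis using truncate_integrable[OF dyadic_piece_L2[OF assms]] by metis
qed

lemma powr_abs_dyadic_le:
  assumes "a > 0" "dyadic_piece g k \<xi> \<noteq> 0"
  shows "\<bar>\<xi>\<bar> powr a \<le> 2 powr (a * k)"
proof -
  have "\<xi> \<in> dyadic_shell k" using assms by (auto simp: dyadic_piece_def indicator_def split: if_splits)
  then have "\<bar>\<xi>\<bar> powr a \<le> (2 powr k) powr a"
    using assms dyadic_shell_upper by (intro powr_mono2) auto
  then show ?thesis by (simp add: powr_powr mult.commute)
qed

text \<open>
  On the \<open>k\<close>-th shell \<open>1 + \<xi>\<^sup>2 \<ge> 4\<^bsup>k-1\<^esup>\<close>, so lowering the Sobolev exponent gains a power of \<open>2\<^sup>k\<close>. This gain is what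
  makes the final series geometric.
\<close>

lemma weighted_energy_dyadic_piece_le:
  assumes "s \<le> \<sigma>" and [measurable]: "g \<in> borel_measurable lebesgue"
  shows "weighted_energy s (dyadic_piece g k) \<le> ennreal ((2 powr (- (real k - 1) * (\<sigma> - s)))\<^sup>2) * weighted_energy \<sigma> g"
proof -
  let ?c = "(2 powr (- (real k - 1) * (\<sigma> - s)))\<^sup>2 :: real"
  have "weighted_energy s (dyadic_piece g k)
      \<le> (\<integral>\<^sup>+ \<xi>. ennreal ?c * ennreal ((1 + \<bar>\<xi>\<bar>\<^sup>2) powr \<sigma> * (cmod (g \<xi>))\<^sup>2) \<partial>lebesgue)"
    unfolding weighted_energy_def
  proof (rule nn_integral_mono)
    fix \<xi> :: real
    show "ennreal ((1 + \<bar>\<xi>\<bar>\<^sup>2) powr s * (cmod (dyadic_piece g k \<xi>))\<^sup>2)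
      \<le> ennreal ?c * ennreal ((1 + \<bar>\<xi>\<bar>\<^sup>2) powr \<sigma> * (cmod (g \<xi>))\<^sup>2)"
    proof (cases "\<xi> \<in> dyadic_shell k")
      case True
      define w where "w = 1 + \<bar>\<xi>\<bar>\<^sup>2"
      have w: "w > 0" unfolding w_def by (simp add: add_pos_nonneg)
      have "?c = 2 powr (2 * (- (real k - 1) * (\<sigma> - s)))"
        by (simp add: powr_powr mult_ac flip: powr_numeral)
      also have "2 * (- (real k - 1) * (\<sigma> - s)) = (2 * (real k - 1)) * (- (\<sigma> - s))"
        by (simp add: algebra_simps)
      also have "2 powr \<dots> = (2 powr (2 * (real k - 1))) powr (- (\<sigma> - s))"
        by (simp add: powr_powr)
      finally have c: "?c = (2 powr (2 * (real k - 1))) powr (- (\<sigma> - s))" .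
      have "w powr s = w powr (- (\<sigma> - s)) * w powr \<sigma>" using w by (simp flip: powr_add)
      also have "\<dots> \<le> ?c * w powr \<sigma>"
        unfolding c using dyadic_shell_lower[OF True] assms(1)
        by (intro mult_right_mono powr_mono2') (auto simp: w_def)
      finally have "w powr s * (cmod (g \<xi>))\<^sup>2 \<le> ?c * w powr \<sigma> * (cmod (g \<xi>))\<^sup>2"
        by (rule mult_right_mono) simp
      then show ?thesis using True
        by (simp add: w_def dyadic_piece_def ennreal_leI mult.assoc flip: ennreal_mult)
    qed (simp add: dyadic_piece_def)
  qed
  also have "\<dots> = ennreal ?c * weighted_energy \<sigma> g"
    unfolding weighted_energy_def by (rule nn_integral_cmult) measurable
  finally show ?thesis .
qed

lemma weighted_energy_mult_le:
  assumes [measurable]: "g \<in> borel_measurable lebesgue" and W: "\<And>\<xi>. g \<xi> \<noteq> 0 \<Longrightarrow> cmod (m \<xi>) \<le> W"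
  shows "weighted_energy s (\<lambda>\<xi>. m \<xi> * g \<xi>) \<le> ennreal (W\<^sup>2) * weighted_energy s g"
proof -
  have "weighted_energy s (\<lambda>\<xi>. m \<xi> * g \<xi>) \<le> (\<integral>\<^sup>+ \<xi>. ennreal (W\<^sup>2) * ennreal ((1 + \<bar>\<xi>\<bar>\<^sup>2) powr s * (cmod (g \<xi>))\<^sup>2) \<partial>lebesgue)"
    unfolding weighted_energy_def
  proof (rule nn_integral_mono)
    fix \<xi> :: real
    have "(cmod (m \<xi> * g \<xi>))\<^sup>2 \<le> W\<^sup>2 * (cmod (g \<xi>))\<^sup>2"
    proof (cases "g \<xi> = 0")
      case False
      then show ?thesis unfolding norm_mult power_mult_distrib
        using W by (intro mult_right_mono power_mono) auto
    qed simp
    then have "(1 + \<bar>\<xi>\<bar>\<^sup>2) powr s * (cmod (m \<xi> * g \<xi>))\<^sup>2 \<le> (1 + \<bar>\<xi>\<bar>\<^sup>2) powr s * (W\<^sup>2 * (cmod (g \<xi>))\<^sup>2)"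
      by (rule mult_left_mono) simp
    then show "ennreal ((1 + \<bar>\<xi>\<bar>\<^sup>2) powr s * (cmod (m \<xi> * g \<xi>))\<^sup>2)
        \<le> ennreal (W\<^sup>2) * ennreal ((1 + \<bar>\<xi>\<bar>\<^sup>2) powr s * (cmod (g \<xi>))\<^sup>2)"
      by (simp add: ennreal_leI mult_ac flip: ennreal_mult)
  qed
  also have "\<dots> = ennreal (W\<^sup>2) * weighted_energy s g"
    unfolding weighted_energy_def by (rule nn_integral_cmult) measurable
  finally show ?thesis .
qed

section \<open>Convergence with a rate\<close>

text \<open>
  The pointwise part of the argument. For each \<open>k\<close> the better of the two bounds depends on \<open>t\<close>; they
  balance at \<open>t = 2\<^bsup>-ka/\<mu>\<^esup>\<close>, and \<open>\<kappa> a / \<mu> = \<delta>\<close> makes the factors \<open>2\<^bsup>k\<delta>\<^esup>\<close> and \<open>2\<^bsup>k(\<delta>-a)\<^esup>\<close> appear. The series at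
  time \<open>0\<close> is only required to converge along a subsequence of its partial sums, because almost
  everywhere convergence from \<open>L\<^sup>2\<close> convergence gives no more.
\<close>

lemma smallo_of_dyadic_bounds:
  fixes a \<gamma> \<delta> :: real and \<phi> :: "nat \<Rightarrow> real \<Rightarrow> complex" and m m' :: "nat \<Rightarrow> real"
  assumes "a > 0" "\<gamma> > 0" "0 \<le> \<delta>" "\<delta> < a"
    and m0: "\<And>k. 0 \<le> m k" "\<And>k. 0 \<le> m' k"
    and m: "\<And>k t. 0 < t \<Longrightarrow> t < 1 \<Longrightarrow> cmod (\<phi> k t - \<phi> k 0) \<le> 2 * m k"
    and m': "\<And>k t. 0 < t \<Longrightarrow> t < 1 \<Longrightarrow> cmod (\<phi> k t - \<phi> k 0) \<le> (t + t powr \<gamma>) * m' k"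
    and summ: "summable (\<lambda>k. 2 powr (\<delta> * k) * m k + 2 powr ((\<delta> - a) * k) * m' k)"
    and F: "\<And>t. 0 < t \<Longrightarrow> t < 1 \<Longrightarrow> (\<lambda>k. \<phi> k t) sums F t"
    and r: "strict_mono r" "(\<lambda>n. \<Sum>k\<le>r n. \<phi> k 0) \<longlonglongrightarrow> f0"
  shows "(\<lambda>t. F t - f0) \<in> o[at_right 0](\<lambda>t. complex_of_real (t powr (\<delta> * min 1 \<gamma> / a)))"
proof -
  define \<mu> where "\<mu> = min 1 \<gamma>"
  define \<kappa> where "\<kappa> = \<delta> * \<mu> / a"
  define A where "A = (\<lambda>k::nat. 2 * (2 powr (\<delta> * k) * m k + 2 powr ((\<delta> - a) * k) * m' k))"
  have \<mu>: "0 < \<mu>" "\<mu> \<le> 1" "\<mu> \<le> \<gamma>" using assms by (auto simp: \<mu>_def)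
  have \<kappa>: "0 \<le> \<kappa>" "\<kappa> < \<mu>" using assms \<mu> by (auto simp: \<kappa>_def field_simps)
  have ev01: "\<forall>\<^sub>F t in at_right 0. 0 < t \<and> t < (1::real)"
    by (auto simp: eventually_at_right_field intro: exI[of _ 1])
  have tpow: "(t + t powr \<gamma>) * m' k \<le> 2 * (t powr \<mu> * m' k)" if "0 < t" "t < 1" for t k
  proof -
    have "t powr 1 \<le> t powr \<mu>" by (rule powr_mono') (use that \<mu> in auto)
    moreover have "t powr \<gamma> \<le> t powr \<mu>" by (rule powr_mono') (use that \<mu> in auto)
    ultimately have "t + t powr \<gamma> \<le> 2 * t powr \<mu>" using that by simp
    then have "(t + t powr \<gamma>) * m' k \<le> (2 * t powr \<mu>) * m' k" by (rule mult_right_mono) (rule m0)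
    then show ?thesis by simp
  qed
  have bound: "cmod (\<phi> k t - \<phi> k 0) \<le> t powr \<kappa> * A k" if t: "0 < t" "t < 1" for k t
  proof -
    \<comment> \<open>The time at which the two bounds balance.\<close>
    define \<tau> where "\<tau> = (2::real) powr (- (k * a / \<mu>))"
    have \<tau>: "\<tau> > 0" by (simp add: \<tau>_def)
    show ?thesis
    proof (cases "\<tau> \<le> t")
      case True
      have "\<tau> powr \<kappa> = 2 powr (- (\<delta> * k))" using assms \<mu> by (simp add: \<tau>_def \<kappa>_def powr_powr mult.commute)
      then have "2 powr (- (\<delta> * k)) \<le> t powr \<kappa>" using True \<tau> \<kappa> powr_mono2[of \<kappa> \<tau> t] by simp
      then have "2 powr (- (\<delta> * k)) * (2 powr (\<delta> * k) * m k) \<le> t powr \<kappa> * (2 powr (\<delta> * k) * m k)"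
        using m0 by (intro mult_right_mono) auto
      then have "m k \<le> t powr \<kappa> * (2 powr (\<delta> * k) * m k)"
        by (simp add: mult.assoc[symmetric] powr_add[symmetric])
      moreover have "0 \<le> t powr \<kappa> * (2 powr ((\<delta> - a) * k) * m' k)" using m0 by simp
      ultimately show ?thesis using m[OF t, of k] unfolding A_def by (simp add: algebra_simps)
    next
      case False
      have "t powr \<mu> = t powr \<kappa> * t powr (\<mu> - \<kappa>)" by (simp flip: powr_add)
      also have "\<dots> \<le> t powr \<kappa> * \<tau> powr (\<mu> - \<kappa>)"
        using False t \<kappa> by (intro mult_left_mono powr_mono2) auto
      also have "\<tau> powr (\<mu> - \<kappa>) = 2 powr ((\<delta> - a) * k)"
      proof -
        have "- (k * a / \<mu>) * (\<mu> - \<kappa>) = (\<delta> - a) * k"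
        proof -
          have "a * \<kappa> = \<mu> * \<delta>" using assms by (simp add: \<kappa>_def)
          have "- (k * a / \<mu>) * (\<mu> - \<kappa>) = - (k / \<mu>) * (a * (\<mu> - \<kappa>))"
            by simp
          also have "a * (\<mu> - \<kappa>) = \<mu> * a - a * \<kappa>" by (simp add: algebra_simps)
          also have "\<dots> = \<mu> * (a - \<delta>)"
            unfolding \<open>a * \<kappa> = \<mu> * \<delta>\<close> by (simp only: right_diff_distrib)
          also have "- (k / \<mu>) * (\<mu> * (a - \<delta>)) = (\<delta> - a) * k" using \<mu> by (simp add: algebra_simps)
          finally show ?thesis .
        qed
        then show ?thesis by (simp add: \<tau>_def powr_powr)
      qed
      finally have "t powr \<mu> * m' k \<le> t powr \<kappa> * 2 powr ((\<delta> - a) * k) * m' k"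
        by (rule mult_right_mono) (rule m0)
      moreover have "0 \<le> t powr \<kappa> * (2 powr (\<delta> * k) * m k)" using m0 by simp
      ultimately show ?thesis using m'[OF t, of k] tpow[OF t, of k] unfolding A_def by (simp add: algebra_simps)
    qed
  qed
  have sA: "summable A" unfolding A_def by (intro summable_mult summ)
  define q where "q = (\<lambda>k t. (\<phi> k t - \<phi> k 0) / complex_of_real (t powr \<kappa>))"
  have q_lim: "(q k \<longlongrightarrow> 0) (at_right 0)" for k
  proof (rule Lim_null_comparison)
    have "((\<lambda>t. t powr (\<mu> - \<kappa>)) \<longlongrightarrow> 0) (at_right 0)"
    proof -
      have "((\<lambda>t::real. t powr (\<mu> - \<kappa>)) \<longlongrightarrow> 0 powr (\<mu> - \<kappa>)) (at_right 0)"
        using \<kappa> by (intro tendsto_powr' tendsto_intros) (auto simp: eventually_at_filter)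
      then show ?thesis by simp
    qed
    then have "((\<lambda>t. 2 * m' k * t powr (\<mu> - \<kappa>)) \<longlongrightarrow> 2 * m' k * 0) (at_right 0)" by (intro tendsto_intros)
    then show "((\<lambda>t. 2 * m' k * t powr (\<mu> - \<kappa>)) \<longlongrightarrow> 0) (at_right 0)" by simp
    show "\<forall>\<^sub>F t in at_right 0. norm (q k t) \<le> 2 * m' k * t powr (\<mu> - \<kappa>)"
      using ev01
    proof eventually_elim
      case (elim t)
      have "cmod (\<phi> k t - \<phi> k 0) \<le> 2 * (t powr \<mu> * m' k)"
        using m'[of t k] tpow[of t k] elim by linarith
      also have "t powr \<mu> = t powr (\<mu> - \<kappa>) * t powr \<kappa>" by (simp flip: powr_add)
      finally show ?case using elim by (simp add: q_def norm_divide divide_le_eq mult_ac)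
    qed
  qed
  have "((\<lambda>t. \<Sum>k. q k t) \<longlongrightarrow> (\<Sum>k. 0)) (at_right 0)"
  proof (rule tannerys_theorem[THEN conjunct2, THEN conjunct2])
    show "(q k \<longlongrightarrow> 0) (at_right 0)" for k by (rule q_lim)
    have "\<forall>\<^sub>F x in at_top \<times>\<^sub>F at_right 0. True \<and> (0 < snd x \<and> snd x < (1::real))"
      using eventually_prodI[OF eventually_True ev01] .
    then show "\<forall>\<^sub>F (k, t) in at_top \<times>\<^sub>F at_right 0. norm (q k t) \<le> A k"
      by eventually_elim
        (use bound in \<open>auto simp: q_def norm_divide divide_le_eq mult_ac split: prod.split\<close>)
    show "summable A" by (rule sA)
  qed simp
  moreover have q_sum: "(\<Sum>k. q k t) = (F t - f0) / complex_of_real (t powr \<kappa>)" if t: "0 < t" "t < 1" for t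
  proof -
    have s: "summable (\<lambda>k. \<phi> k t - \<phi> k 0)"
      by (rule summable_comparison_test'[of "\<lambda>k. t powr \<kappa> * A k" 0]) (use bound t sA in auto)
    then have "(\<lambda>n. \<Sum>k\<le>n. \<phi> k t - \<phi> k 0) \<longlonglongrightarrow> (\<Sum>k. \<phi> k t - \<phi> k 0)"
      using summable_sums sums_def_le by blast
    from LIMSEQ_subseq_LIMSEQ[OF this r(1)]
    have "(\<lambda>n. \<Sum>k\<le>r n. \<phi> k t - \<phi> k 0) \<longlonglongrightarrow> (\<Sum>k. \<phi> k t - \<phi> k 0)" by (simp add: o_def)
    moreover have "(\<lambda>n. \<Sum>k\<le>n. \<phi> k t) \<longlonglongrightarrow> F t" using F[OF t] by (simp add: sums_def_le)
    from LIMSEQ_subseq_LIMSEQ[OF this r(1)]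
    have "(\<lambda>n. \<Sum>k\<le>r n. \<phi> k t - \<phi> k 0) \<longlonglongrightarrow> F t - f0"
      using r(2) by (simp add: o_def sum_subtractf tendsto_diff)
    ultimately have "(\<Sum>k. \<phi> k t - \<phi> k 0) = F t - f0" by (rule LIMSEQ_unique)
    then show ?thesis unfolding q_def using suminf_divide[OF s] by simp
  qed
  ultimately have lim: "((\<lambda>t. \<Sum>k. q k t) \<longlongrightarrow> 0) (at_right 0)" by simp
  show ?thesis
  proof (rule landau_o.smallI)
    fix c :: real assume c: "c > 0"
    have "\<forall>\<^sub>F t in at_right 0. norm (\<Sum>k. q k t) < c"
      using tendstoD[OF lim c] by simp
    then show "\<forall>\<^sub>F t in at_right 0. norm (F t - f0) \<le> c * norm (complex_of_real (t powr (\<delta> * min 1 \<gamma> / a)))"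
      using ev01
    proof eventually_elim
      case (elim t)
      then have "cmod (F t - f0) / t powr \<kappa> < c" using q_sum[of t] by (simp add: norm_divide)
      then have "cmod (F t - f0) \<le> c * t powr \<kappa>" using elim by (simp add: divide_less_eq)
      then show ?case by (simp add: \<kappa>_def \<mu>_def)
    qed
  qed
qed

lemma sum_dyadic_piece: "(\<Sum>k\<le>n. dyadic_piece g k \<xi>) = truncate (2 ^ n) g \<xi>"
  by (simp add: dyadic_piece_def sum_indicator_dyadic_shell flip: sum_distrib_right)

lemma sum_evolution_dyadic_piece:
  assumes "g \<in> L2" "Re z \<le> 0"
  shows "(\<Sum>k\<le>n. evolution a z (dyadic_piece g k) x) = evolution a z (truncate (2 ^ n) g) x"
  using evolution_sum[of "{..n}" "dyadic_piece g" z a x] assms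
  by (simp add: dyadic_piece_integrable sum_dyadic_piece)

lemma dyadic_piece_multiplier:
  assumes "a > 0" and g: "g \<in> L2"
  shows "(\<lambda>\<xi>. complex_of_real (\<bar>\<xi>\<bar> powr a) * dyadic_piece g k \<xi>) \<in> L2" (is "?u \<in> L2")
    and "integrable lebesgue (\<lambda>\<xi>. complex_of_real (\<bar>\<xi>\<bar> powr a) * dyadic_piece g k \<xi>)"
proof -
  let ?m = "\<lambda>\<xi>. complex_of_real (\<bar>\<xi>\<bar> powr a) * indicator (dyadic_shell k) \<xi>"
  have "?u = (\<lambda>\<xi>. ?m \<xi> * g \<xi>)" by (simp add: dyadic_piece_def mult_ac)
  moreover have "(\<lambda>\<xi>. ?m \<xi> * g \<xi>) \<in> L2"
  proof (rule L2_mult_bounded[OF _ _ g])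
    show "cmod (?m \<xi>) \<le> 2 powr (a * k)" for \<xi>
      using powr_abs_dyadic_le[OF \<open>a > 0\<close>, of "\<lambda>_. 1" k \<xi>] by (auto simp: indicator_def dyadic_piece_def)
    have [measurable]: "dyadic_shell k \<in> sets lebesgue" by (simp add: dyadic_shell_def)
    show "?m \<in> borel_measurable lebesgue" by measurable
  qed
  ultimately show u: "?u \<in> L2" by simp
  have "?u = truncate (2 ^ k) ?u"
    using dyadic_shell_subset[of k] by (auto simp: dyadic_piece_def indicator_def fun_eq_iff)
  then show "integrable lebesgue ?u" using truncate_integrable[OF u] by metis
qed

text \<open>
  The pointwise criterion applies wherever the series of weighted maximal functions converges. Its
  integral over the ball is dominated by a geometric series with ratio \<open>2\<^bsup>-(s-s')\<^esup>\<close>.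
\<close>

lemma AE_landau_convergence_on_ball:
  assumes "a > 0" "\<gamma> > 0" "p \<ge> 1" "s > s'" "0 \<le> \<delta>" "\<delta> < a" and C: "C \<ge> 0"
    and max: "\<And>f. f \<in> sobolev s' \<Longrightarrow> Lp_norm p (ball 0 1)
          (\<lambda>x. SUP t \<in> {0<..<1}. ennreal (cmod (landau_schroedinger a \<gamma> t f x))) \<le> ennreal (C * sobolev_norm s' f)"
    and f: "f \<in> sobolev (s + \<delta>)"
  shows "AE x in lebesgue. x \<in> ball y 1 \<longrightarrow>
     (\<lambda>t. landau_schroedinger a \<gamma> t f x - f x) \<in> o[at_right 0](\<lambda>t. complex_of_real (t powr (\<delta> * min 1 \<gamma> / a)))"
proof -
  have fL2: "f \<in> L2" using f by (simp add: sobolev_def)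
  define g where "g = fourier f"
  have gL2: "g \<in> L2" using is_fourier_fourier[OF fL2] by (simp add: is_fourier_iff g_def)
  have [measurable]: "g \<in> borel_measurable lebesgue" using gL2 by (rule L2_measurable)
  define \<sigma> where "\<sigma> = s + \<delta>"
  define J where "J = (LINT \<xi>|lebesgue. (1 + \<bar>\<xi>\<bar>\<^sup>2) powr \<sigma> * (cmod (g \<xi>))\<^sup>2)"
  have J0: "J \<ge> 0" unfolding J_def by (intro Bochner_Integration.integral_nonneg) auto
  have J: "weighted_energy \<sigma> g = ennreal J"
    unfolding weighted_energy_def J_def using f
    by (intro nn_integral_eq_integral) (auto simp: sobolev_def g_def \<sigma>_def)
  define gk where "gk = dyadic_piece g"
  define hk where "hk = (\<lambda>k \<xi>. complex_of_real (\<bar>\<xi>\<bar> powr a) * gk k \<xi>)"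
  have gk: "gk k \<in> L2" "integrable lebesgue (gk k)" for k
    unfolding gk_def by (rule dyadic_piece_L2[OF gL2] dyadic_piece_integrable[OF gL2])+
  have hk: "hk k \<in> L2" "integrable lebesgue (hk k)" for k
    unfolding hk_def gk_def by (rule dyadic_piece_multiplier[OF \<open>a > 0\<close> gL2])+
  have W: "gk k \<xi> \<noteq> 0 \<Longrightarrow> \<bar>\<xi>\<bar> powr a \<le> 2 powr (a * k)" for k \<xi>
    unfolding gk_def using powr_abs_dyadic_le[OF \<open>a > 0\<close>] by blast
  \<comment> \<open>A bound for the \<open>H\<^bsup>s'\<^esup>\<close> norm of the \<open>k\<close>-th piece; \<open>2\<^bsup>ak\<^esup> N k\<close> bounds that of \<open>\<bar>\<xi>\<bar>\<^sup>a\<close> times the piece.\<close>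
  define N where "N = (\<lambda>k::nat. 2 powr (- (real k - 1) * (\<sigma> - s')) * sqrt J)"
  have N0: "N k \<ge> 0" for k using J0 by (simp add: N_def)
  have eg: "weighted_energy s' (gk k) \<le> ennreal ((N k)\<^sup>2)" for k
    using weighted_energy_dyadic_piece_le[of s' \<sigma> g k] J J0 assms
    by (simp add: N_def gk_def \<sigma>_def power_mult_distrib ennreal_mult)
  have eh: "weighted_energy s' (hk k) \<le> ennreal ((2 powr (a * k) * N k)\<^sup>2)" for k
  proof -
    have "weighted_energy s' (hk k) \<le> ennreal ((2 powr (a * k))\<^sup>2) * weighted_energy s' (gk k)"
      unfolding hk_def using W gk(1) by (intro weighted_energy_mult_le) (auto intro: L2_measurable)
    also have "\<dots> \<le> ennreal ((2 powr (a * k))\<^sup>2) * ennreal ((N k)\<^sup>2)"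
      by (intro mult_left_mono eg) simp
    finally show ?thesis by (simp add: power_mult_distrib ennreal_mult)
  qed
  define M where "M = (\<lambda>k. landau_maximal a \<gamma> (gk k))"
  define M' where "M' = (\<lambda>k. landau_maximal a \<gamma> (hk k))"
  have [measurable]: "M k \<in> borel_measurable lebesgue" "M' k \<in> borel_measurable lebesgue" for k
    unfolding M_def M'_def by (intro measurable_completion; simp add: landau_maximal_measurable gk hk)+
  have [measurable]: "ball y 1 \<in> sets lebesgue" by simp
  have intM: "(\<integral>\<^sup>+x\<in>ball y 1. M k x \<partial>lebesgue) \<le> ennreal (3 * (C * N k))" for k
    unfolding M_def by (rule maximal_estimate_L1[OF \<open>p \<ge> 1\<close> C max gk N0 eg])
  have intM': "(\<integral>\<^sup>+x\<in>ball y 1. M' k x \<partial>lebesgue) \<le> ennreal (3 * (C * (2 powr (a * k) * N k)))" for k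
    unfolding M'_def using N0 by (intro maximal_estimate_L1[OF \<open>p \<ge> 1\<close> C max hk _ eh]) auto
  define G where "G = (\<lambda>k x. ennreal (2 powr (\<delta> * k)) * M k x + ennreal (2 powr ((\<delta> - a) * k)) * M' k x)"
  have [measurable]: "G k \<in> borel_measurable lebesgue" for k unfolding G_def by measurable
  define K where "K = 6 * C * sqrt J * 2 powr (\<sigma> - s')"
  have intG: "(\<integral>\<^sup>+x\<in>ball y 1. G k x \<partial>lebesgue) \<le> ennreal (K * (2 powr (- (s - s'))) ^ k)" for k
  proof -
    have "(\<integral>\<^sup>+x\<in>ball y 1. G k x \<partial>lebesgue) =
       (\<integral>\<^sup>+x. ennreal (2 powr (\<delta> * k)) * (M k x * indicator (ball y 1) x)
          + ennreal (2 powr ((\<delta> - a) * k)) * (M' k x * indicator (ball y 1) x) \<partial>lebesgue)"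
      by (intro nn_integral_cong) (simp add: G_def distrib_right mult.assoc)
    also have "\<dots> = ennreal (2 powr (\<delta> * k)) * (\<integral>\<^sup>+x\<in>ball y 1. M k x \<partial>lebesgue)
          + ennreal (2 powr ((\<delta> - a) * k)) * (\<integral>\<^sup>+x\<in>ball y 1. M' k x \<partial>lebesgue)"
      by (subst nn_integral_add; (subst nn_integral_cmult)?; (subst nn_integral_cmult)?) measurable
    also have "\<dots> \<le> ennreal (2 powr (\<delta> * k)) * ennreal (3 * (C * N k))
          + ennreal (2 powr ((\<delta> - a) * k)) * ennreal (3 * (C * (2 powr (a * k) * N k)))"
      by (intro add_mono mult_left_mono intM intM') auto
    also have "\<dots> = ennreal (2 powr (\<delta> * k) * (3 * (C * N k)) + 2 powr ((\<delta> - a) * k) * (3 * (C * (2 powr (a * k) * N k))))"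
      using C N0 by (simp add: ennreal_mult)
    also have "2 powr (\<delta> * k) * (3 * (C * N k)) + 2 powr ((\<delta> - a) * k) * (3 * (C * (2 powr (a * k) * N k)))
        = 6 * C * (2 powr (\<delta> * k) * N k)"
    proof -
      have "2 powr ((\<delta> - a) * k) * 2 powr (a * k) = (2 powr (\<delta> * k) :: real)"
        by (simp add: algebra_simps flip: powr_add)
      then have "2 powr ((\<delta> - a) * k) * (3 * (C * (2 powr (a * k) * N k))) = 3 * C * (2 powr (\<delta> * k) * N k)"
        by (metis (no_types, opaque_lifting) mult.assoc mult.left_commute)
      then show ?thesis by simp
    qed
    also have "\<dots> = K * (2 powr (- (s - s'))) ^ k"
    proof -
      have "\<delta> * k + - (real k - 1) * (\<sigma> - s') = (\<sigma> - s') + - (s - s') * k"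
        by (simp add: \<sigma>_def algebra_simps)
      then have "2 powr (\<delta> * k) * 2 powr (- (real k - 1) * (\<sigma> - s')) = (2 powr (\<sigma> - s') * 2 powr (- (s - s') * k) :: real)"
        by (simp flip: powr_add)
      moreover have "(2 powr (- (s - s'))) ^ k = (2 powr (- (s - s') * k) :: real)"
        by (simp add: powr_powr flip: powr_realpow)
      ultimately show ?thesis unfolding K_def N_def by (simp only: mult_ac)
    qed
    finally show ?thesis .
  qed
  have "2 powr (- (s - s')) < (2::real) powr 0" using assms by (intro powr_less_mono) auto
  then have geo: "summable (\<lambda>k. K * (2 powr (- (s - s'))) ^ k)"
    by (intro summable_mult summable_geometric) simp
  have K0: "K \<ge> 0" using C J0 by (simp add: K_def)
  have "(\<integral>\<^sup>+x. (\<Sum>k. G k x * indicator (ball y 1) x) \<partial>lebesgue) = (\<Sum>k. (\<integral>\<^sup>+x\<in>ball y 1. G k x \<partial>lebesgue))"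
    by (rule nn_integral_suminf) measurable
  also have "\<dots> \<le> (\<Sum>k. ennreal (K * (2 powr (- (s - s'))) ^ k))"
    by (intro suminf_le intG) auto
  also have "\<dots> < \<infinity>"
  proof -
    have "(\<Sum>k. ennreal (K * (2 powr (- (s - s'))) ^ k)) \<noteq> top"
      by (rule ennreal_suminf_neq_top[OF geo]) (use K0 in auto)
    then show ?thesis unfolding infinity_ennreal_def by (simp only: less_top)
  qed
  finally have finG: "AE x in lebesgue. (\<Sum>k. G k x * indicator (ball y 1) x) \<noteq> \<infinity>"
    by (intro nn_integral_noteq_infinite) auto
  have trunc: "filterlim (\<lambda>n::nat. (2::real) ^ n) at_top sequentially"
    by (rule filterlim_at_top_mono[OF filterlim_real_sequentially always_eventually])
      (blast intro: less_imp_le of_nat_less_two_power)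
  obtain r :: "nat \<Rightarrow> nat" where r: "strict_mono r"
    and conv: "AE x in lebesgue. (\<lambda>n. evolution a 0 (truncate (2 ^ r n) g) x) \<longlonglongrightarrow> f x"
  proof (rule energy_tendsto_AE_subseq)
    show "evolution a 0 (truncate (2 ^ n) g) \<in> L2" for n by (rule evolution_0_truncate_L2[OF gL2])
    show "f \<in> L2" by (rule fL2)
    show "(\<lambda>n. energy (\<lambda>x. evolution a 0 (truncate (2 ^ n) g) x - f x)) \<longlonglongrightarrow> 0"
      using filterlim_compose[OF evolution_0_truncate_tendsto[OF fL2] trunc] by (simp add: g_def)
  qed
  show ?thesis
    using finG conv
  proof (eventually_elim, intro impI)
    fix x
    assume fin: "(\<Sum>k. G k x * indicator (ball y 1) x) \<noteq> \<infinity>"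
      and conv: "(\<lambda>n. evolution a 0 (truncate (2 ^ r n) g) x) \<longlonglongrightarrow> f x" and x: "x \<in> ball y 1"
    define \<phi> where "\<phi> = (\<lambda>k t. evolution a (landau_time \<gamma> t) (gk k) x)"
    have finS: "(\<Sum>k. G k x) \<noteq> top" using fin x by simp
    have "G k x \<noteq> top" for k
      using ennreal_suminf_lessD[of "\<lambda>k. G k x" top k] finS by (auto simp: less_top)
    then have top: "M k x \<noteq> top" "M' k x \<noteq> top" for k
      by (auto simp: G_def ennreal_mult_eq_top_iff)
    define m where "m = (\<lambda>k. enn2real (M k x))"
    define m' where "m' = (\<lambda>k. enn2real (M' k x))"
    have mM: "M k x = ennreal (m k)" "M' k x = ennreal (m' k)" for k
      using top by (auto simp: m_def m'_def ennreal_enn2real less_top)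
    have m0: "0 \<le> m k" "0 \<le> m' k" for k by (simp_all add: m_def m'_def)
    have phi_m: "cmod (\<phi> k t) \<le> m k" if "0 < t" "t < 1" for k t
    proof -
      have "ennreal (cmod (\<phi> k t)) \<le> M k x"
        unfolding M_def landau_maximal_def \<phi>_def using that by (intro SUP_upper) auto
      then show ?thesis using m0 by (simp add: mM)
    qed
    have psi_m: "cmod (evolution a (landau_time \<gamma> t) (hk k) x) \<le> m' k" if "0 < t" "t < 1" for k t
    proof -
      have "ennreal (cmod (evolution a (landau_time \<gamma> t) (hk k) x)) \<le> M' k x"
        unfolding M'_def landau_maximal_def using that by (intro SUP_upper) auto
      then show ?thesis using m0 by (simp add: mM)
    qed
    \<comment> \<open>Time \<open>0\<close> lies outside the supremum, and is reached by continuity.\<close>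
    have phi_0: "cmod (\<phi> k 0) \<le> m k" for k
    proof (rule tendsto_upperbound)
      have "continuous_on {0..} (\<phi> k)"
        unfolding \<phi>_def by (rule evolution_time_continuous[OF gk(2) W \<open>\<gamma> > 0\<close>])
      then have "(\<phi> k \<longlongrightarrow> \<phi> k 0) (at 0 within {0..})" by (auto simp: continuous_on)
      then have "(\<phi> k \<longlongrightarrow> \<phi> k 0) (at_right 0)" by (rule tendsto_within_subset) auto
      then show "((\<lambda>t. cmod (\<phi> k t)) \<longlongrightarrow> cmod (\<phi> k 0)) (at_right 0)" by (rule tendsto_norm)
      show "\<forall>\<^sub>F t in at_right 0. cmod (\<phi> k t) \<le> m k"
        using phi_m by (auto simp: eventually_at_right_field intro!: exI[of _ 1])
    qed simp
    show "(\<lambda>t. landau_schroedinger a \<gamma> t f x - f x) \<in> o[at_right 0](\<lambda>t. complex_of_real (t powr (\<delta> * min 1 \<gamma> / a)))"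
    proof (rule smallo_of_dyadic_bounds[where \<phi> = \<phi> and m = m and m' = m' and r = r])
      show "cmod (\<phi> k t - \<phi> k 0) \<le> 2 * m k" if "0 < t" "t < 1" for k t
        using norm_triangle_ineq4[of "\<phi> k t" "\<phi> k 0"] phi_m[OF that, of k] phi_0[of k] by linarith
      show "cmod (\<phi> k t - \<phi> k 0) \<le> (t + t powr \<gamma>) * m' k" if "0 < t" "t < 1" for k t
        using evolution_difference_le[OF gk(2) W \<open>\<gamma> > 0\<close> that psi_m[unfolded hk_def]] by (simp add: \<phi>_def)
      have "G k x = ennreal (2 powr (\<delta> * k) * m k + 2 powr ((\<delta> - a) * k) * m' k)" for k
        using m0 by (simp add: G_def mM ennreal_mult)
      then show "summable (\<lambda>k. 2 powr (\<delta> * k) * m k + 2 powr ((\<delta> - a) * k) * m' k)"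
        using finS m0 by (intro summable_suminf_not_top) auto
      show "(\<lambda>k. \<phi> k t) sums landau_schroedinger a \<gamma> t f x" if "0 < t" "t < 1" for t
      proof -
        have "(\<Sum>k\<le>n. \<phi> k t) = evolution a (landau_time \<gamma> t) (truncate (2 ^ n) g) x" for n
          unfolding \<phi>_def gk_def by (rule sum_evolution_dyadic_piece[OF gL2]) simp
        then show ?thesis
          unfolding sums_def_le landau_schroedinger_eq_evolution g_def[symmetric]
          using evolution_truncate_tendsto[OF \<open>a > 0\<close> _ gL2, of "landau_time \<gamma> t" x] that by simp
      qed
      show "(\<lambda>n. \<Sum>k\<le>r n. \<phi> k 0) \<longlonglongrightarrow> f x"
        using conv unfolding \<phi>_def gk_def landau_time_0 by (subst sum_evolution_dyadic_piece[OF gL2]) auto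
    qed (use assms m0 r in auto)
  qed
qed

theorem theorem1p4:
  fixes \<gamma> a p s\<^sub>0 :: real
  assumes "\<gamma> > 0" and "a > 0" and "p \<ge> 1" and "s\<^sub>0 \<ge> 0"
    and maximal: "\<And>s. s > s\<^sub>0 \<Longrightarrow>
      \<exists>C::real. C \<ge> 0 \<and> (\<forall>f \<in> sobolev s.
        Lp_norm p (ball 0 1)
          (\<lambda>x. SUP t \<in> {0<..<1}. ennreal (cmod (landau_schroedinger a \<gamma> t f x)))
        \<le> ennreal (C * sobolev_norm s f))"
  shows "\<forall>s \<delta>. s > s\<^sub>0 \<longrightarrow> 0 \<le> \<delta> \<longrightarrow> \<delta> < a \<longrightarrow>
      (\<forall>f \<in> sobolev (s + \<delta>).
        AE x in lebesgue.
          (\<lambda>t. landau_schroedinger a \<gamma> t f x - f x)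
            \<in> o[at_right 0](\<lambda>t. complex_of_real (t powr (\<delta> * min 1 \<gamma> / a))))"
proof (intro allI impI ballI)
  fix s \<delta> :: real and f
  assume s: "s > s\<^sub>0" and \<delta>: "0 \<le> \<delta>" "\<delta> < a" and f: "f \<in> sobolev (s + \<delta>)"
  define s' where "s' = (s\<^sub>0 + s) / 2"
  have s': "s' > s\<^sub>0" "s > s'" using s by (auto simp: s'_def)
  obtain C where C: "C \<ge> 0" and max: "\<And>f. f \<in> sobolev s' \<Longrightarrow> Lp_norm p (ball 0 1)
      (\<lambda>x. SUP t \<in> {0<..<1}. ennreal (cmod (landau_schroedinger a \<gamma> t f x))) \<le> ennreal (C * sobolev_norm s' f)"
    using maximal[OF s'(1)] by blast
  \<comment> \<open>Countably many unit balls cover the line.\<close>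
  have "AE x in lebesgue. \<forall>i::int. x \<in> ball (of_int i) 1 \<longrightarrow>
     (\<lambda>t. landau_schroedinger a \<gamma> t f x - f x) \<in> o[at_right 0](\<lambda>t. complex_of_real (t powr (\<delta> * min 1 \<gamma> / a)))"
    unfolding AE_all_countable
    using AE_landau_convergence_on_ball[OF assms(2,1,3) s'(2) \<delta> C max f] by blast
  then show "AE x in lebesgue. (\<lambda>t. landau_schroedinger a \<gamma> t f x - f x)
      \<in> o[at_right 0](\<lambda>t. complex_of_real (t powr (\<delta> * min 1 \<gamma> / a)))"
  proof eventually_elim
    case (elim x)
    have "x \<in> ball (of_int \<lfloor>x\<rfloor>) 1" by (simp add: dist_real_def abs_real_def) linarith
    with elim show ?case by blast
  qed
qed

end
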